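(* Let $K$ be a number field, let $\mathfrak{d}$ be a dyadic place of $K$, and let $a\in K$ be nonzero. Then the length $\ell_{\mathfrak d}(a)$ of $a$ in the completion $K_{\mathfrak d}$ is given by the following procedure (that is, the procedure correctly returns $\ell_{\mathfrak d}(a)$): \begin{itemize} \item if $a$ is a square in $K_{\mathfrak d}$, then $\ell_{\mathfrak d}(a)=1$; \item otherwise, if $(-1,a)_{\mathfrak d}=1$, then $\ell_{\mathfrak d}(a)=2$; \item otherwise, if $(-1,-1)_{\mathfrak d}=1$ or $-a$ is not a square in $K_{\mathfrak d}$, then $\ell_{\mathfrak d}(a)=3$; \item otherwise, $\ell_{\mathfrak d}(a)=4$. \end{itemize}
   Context: A dyadic place of a number field $K$ is a finite place dividing $2$. $K_{\mathfrak d}$ is the completion of $K$ at $\mathfrak d$ and $(\cdot,\cdot)_{\mathfrak d}$ is the Hilbert symbol of $K_{\mathfrak d}$: $(x,y)_{\mathfrak d}=1$ if the quadratic form $\langle x,y\rangle$ represents $1$ over $K_{\mathfrak d}$, and $-1$ otherwise. The length $\ell_{\mathfrak d}(a)$ of a nonzero element $a$ in $K_{\mathfrak d}$ is the minimal number of summands needed to write $a$ as a sum of squares of elements of $K_{\mathfrak d}$, and is $\infty$ if $a$ is not such a sum. *)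

theory Defs
  imports
    "HOL-Analysis.Analysis"
    "HOL-Computational_Algebra.Nth_Powers"
    "HOL-Library.Extended_Nat"
begin

text \<open>A number field is a field of characteristic zero of finite dimension over the rationals;
  the whole type plays the role of the field.\<close>

definition number_field :: "'k :: field_char_0 itself \<Rightarrow> bool" where
  "number_field _ \<longleftrightarrow>
    (\<exists>B :: 'k set. finite B \<and> module.span (\<lambda>q :: rat. (*) (of_rat q :: 'k)) B = UNIV)"

locale absolute_value =
  fixes v :: "'a :: field \<Rightarrow> real"
  assumes nonneg: "0 \<le> v x"
    and eq_0_iff: "v x = 0 \<longleftrightarrow> x = 0"
    and mult: "v (x * y) = v x * v y"
    and triangle: "v (x + y) \<le> v x + v y"

text \<open>A finite place is an equivalence class of nontrivial non-archimedean absolute values. It is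
  given here by an arbitrary representative: equivalent absolute values yield the same completion.
  The place divides 2 iff 2 has absolute value less than 1.\<close>

locale finite_place = absolute_value v for v :: "'a :: field \<Rightarrow> real" +
  assumes nontrivial: "\<exists>x. x \<noteq> 0 \<and> v x \<noteq> 1"
    and ultrametric: "v (x + y) \<le> max (v x) (v y)"

locale dyadic_place = finite_place v for v :: "'a :: field \<Rightarrow> real" +
  assumes dvd_2: "v 2 < 1"

definition val_dist :: "('a :: field \<Rightarrow> real) \<Rightarrow> 'a \<Rightarrow> 'a \<Rightarrow> real" where
  "val_dist v x y = v (x - y)"

text \<open>A completion of the valued field \<open>(K, v)\<close> is a complete valued field \<open>(L, w)\<close> together with
  an isometric field embedding \<open>\<iota> : K \<rightarrow> L\<close> with dense image. It is unique up to a unique isometric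
  isomorphism over \<open>K\<close>.\<close>

locale valued_field_completion =
  base: absolute_value v + compl: absolute_value w
  for v :: "'k :: field \<Rightarrow> real" and w :: "'l :: field \<Rightarrow> real" +
  fixes \<iota> :: "'k \<Rightarrow> 'l"
  assumes hom_one: "\<iota> 1 = 1"
    and hom_add: "\<iota> (x + y) = \<iota> x + \<iota> y"
    and hom_mult: "\<iota> (x * y) = \<iota> x * \<iota> y"
    and isometric: "w (\<iota> x) = v x"
    and dense: "Metric_space.mtopology UNIV (val_dist w) closure_of range \<iota> = UNIV"
    and complete: "Metric_space.mcomplete UNIV (val_dist w)"

definition hilbert_symbol :: "'l :: field \<Rightarrow> 'l \<Rightarrow> int" where
  "hilbert_symbol x y = (if \<exists>s t. x * s\<^sup>2 + y * t\<^sup>2 = 1 then 1 else - 1)"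

text \<open>The infimum of the empty set of extended naturals is \<open>\<infinity>\<close>.\<close>

definition sos_length :: "'l :: field \<Rightarrow> enat" where
  "sos_length a = Inf {enat n | n. \<exists>f :: nat \<Rightarrow> 'l. a = (\<Sum>i<n. (f i)\<^sup>2)}"

text \<open>The locale \<open>Metric_space\<close> only yields the intended notions for an actual metric.\<close>

lemma (in absolute_value) Metric_space_val_dist: "Metric_space UNIV (val_dist v)"
proof
  have one: "v 1 = 1"
    using mult[of 1 1] eq_0_iff[of 1] by simp
  have "v (- 1) * v (- 1) = 1"
    using mult[of "- 1" "- 1"] one by simp
  then have "v (- 1) = 1"
    using nonneg[of "- 1"] square_eq_1_iff by fastforce
  then have minus: "v (- x) = v x" for x
    using mult[of "- 1" x] by simp
  show "0 \<le> val_dist v x y" for x y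
    by (simp add: val_dist_def nonneg)
  show "val_dist v x y = val_dist v y x" for x y
    using minus[of "x - y"] by (simp add: val_dist_def)
  show "val_dist v x y = 0 \<longleftrightarrow> x = y" for x y
    by (simp add: val_dist_def eq_0_iff)
  show "val_dist v x z \<le> val_dist v x y + val_dist v y z" for x y z
    using triangle[of "x - y" "y - z"] by (simp add: val_dist_def)
qed

end

theory Submission
  imports Defs
begin

text \<open>The point of the theorem is that every nonzero \<open>a\<close> with \<open>- a\<close> not a square is a sum of three
  squares in a dyadic local field; the remaining cases are formal, using that \<open>- 7\<close> is a dyadic
  square. The form \<open>x\<^sup>2 + y\<^sup>2 + z\<^sup>2\<close> is equivalent to \<open>3 t\<^sup>2 + 2 (u\<^sup>2 + u v + v\<^sup>2)\<close>, and \<open>u\<^sup>2 + u v + v\<^sup>2\<close>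
  represents all elements of even order. So it suffices to find \<open>t\<close> such that \<open>a - 3 t\<^sup>2\<close> has the
  same parity of order as \<open>2\<close>. If \<open>2\<close> has even order, any large \<open>t\<close> will do. If \<open>2\<close> has odd order,
  \<open>t\<close> is taken from the quadratic defect of \<open>a / 3\<close>; it only fails if \<open>a / 3\<close> is a unit of the form
  \<open>1 + 4 c\<close> up to squares with \<open>x\<^sup>2 + x = c\<close> insoluble in the residue field. As the Artin--Schreier
  map of a finite field of characteristic 2 has image of index 2, such a unit lies in the square
  class of \<open>- 3\<close> (unless \<open>- 3\<close> is a square), so that \<open>- a\<close> is a square.\<close>

text \<open>The witnesses solve h + k = a and h - k = 1. The factor \<open>- 1\<close> stays visible
  so that an expression of -1 by squares can be substituted for it.\<close>

lemma difference_of_two_squares: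
  fixes a :: "'a :: field"
  assumes "(2 :: 'a) \<noteq> 0"
  obtains h k where "a = h\<^sup>2 + - 1 * k\<^sup>2"
proof -
  define h k where "h = (a + 1) / 2" and "k = (a - 1) / 2"
  have "h + k = (a + 1 + (a - 1)) / 2" and "h - k = (a + 1 - (a - 1)) / 2"
    by (simp_all only: h_def k_def add_divide_distrib diff_divide_distrib)
  then have "h + k = a" and "h - k = 1"
    using assms by (simp_all flip: mult_2)
  then have "a = (h + k) * (h - k)"
    by simp
  also have "\<dots> = h\<^sup>2 + - 1 * k\<^sup>2"
    by (simp add: power2_eq_square algebra_simps)
  finally show thesis ..
qed

section \<open>Absolute values\<close>

context absolute_value
begin

lemma val_0 [simp]: "v 0 = 0"
  by (simp add: eq_0_iff)

lemma val_1 [simp]: "v 1 = 1"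
  using mult[of 1 1] eq_0_iff[of 1] by simp

lemma val_minus [simp]: "v (- x) = v x"
proof -
  interpret Metric_space UNIV "val_dist v"
    by (rule Metric_space_val_dist)
  show ?thesis
    using commute[of x 0] by (simp add: val_dist_def)
qed

lemma val_minus_commute: "v (x - y) = v (y - x)"
  using val_minus[of "x - y"] by simp

lemma val_power: "v (x ^ n) = v x ^ n"
  by (induction n) (simp_all add: mult)

lemma val_pos_iff: "0 < v x \<longleftrightarrow> x \<noteq> 0"
  using nonneg[of x] eq_0_iff[of x] by linarith

lemma val_inverse: "v (inverse x) = inverse (v x)"
proof (cases "x = 0")
  case False
  then have "v x * v (inverse x) = 1"
    using mult[of x "inverse x"] by simp
  then show ?thesis
    by (simp add: inverse_unique)
qed simp

lemma val_divide: "v (x / y) = v x / v y"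
  by (simp add: divide_inverse mult val_inverse)

lemma val_power_int: "v (x powi z) = v x powi z"
  by (simp add: power_int_def val_power val_inverse)

end

context finite_place
begin

lemma val_diff_le: "v (x - y) \<le> max (v x) (v y)"
  using ultrametric[of x "- y"] by simp

lemma val_add_less: "v x < c \<Longrightarrow> v y < c \<Longrightarrow> v (x + y) < c"
  using ultrametric[of x y] by linarith

lemma val_diff_less: "v x < c \<Longrightarrow> v y < c \<Longrightarrow> v (x - y) < c"
  using val_diff_le[of x y] by linarith

lemma val_add_le: "v x \<le> c \<Longrightarrow> v y \<le> c \<Longrightarrow> v (x + y) \<le> c"
  using ultrametric[of x y] by linarith

lemma val_add_eq:
  assumes "v y < v x"
  shows "v (x + y) = v x"
  using ultrametric[of x y] val_diff_le[of "x + y" y] assms by auto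

lemma val_eq_of_close:
  assumes "v (x - y) < v x"
  shows "v y = v x"
  using val_add_eq[of "y - x" x] assms by (simp add: val_minus_commute)

lemma val_of_nat_le: "v (of_nat n) \<le> 1"
  by (induction n) (auto intro: val_add_le)

lemma val_of_int_le: "v (of_int z) \<le> 1"
proof (cases z)
  case (nonneg n)
  then show ?thesis using val_of_nat_le[of n] by simp
next
  case (neg n)
  then show ?thesis using val_of_nat_le[of "Suc n"] by (metis val_minus of_int_minus of_int_of_nat_eq)
qed

lemma val_sum_less:
  assumes "finite S" "0 < c" "\<And>i. i \<in> S \<Longrightarrow> v (f i) < c"
  shows "v (\<Sum>i\<in>S. f i) < c"
  using assms(1,3)
  by (induction S rule: finite_induct) (use assms(2) in \<open>auto intro: val_add_less\<close>)

lemma val_mult_less_1: "v x < 1 \<Longrightarrow> v y \<le> 1 \<Longrightarrow> v (x * y) < 1"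
  using mult_left_le[of "v y" "v x"] nonneg[of x] by (simp add: mult)

lemma val_mult_le_1: "v x \<le> 1 \<Longrightarrow> v y \<le> 1 \<Longrightarrow> v (x * y) \<le> 1"
  by (simp add: mult mult_le_one nonneg)

lemma val_power2_less_1D: "v (x\<^sup>2) < 1 \<Longrightarrow> v x < 1"
  using one_le_power[of "v x" 2] by (auto simp: val_power not_less[symmetric])

lemma val_congruent_trans: "v (x - y) < c \<Longrightarrow> v (y - z) < c \<Longrightarrow> v (x - z) < c"
  using val_add_less[of "x - y" c "y - z"] by simp

end

context dyadic_place
begin

lemma val_odd: "v (1 + 2 * x) = 1" if "v x \<le> 1"
  using val_add_eq[of "2 * x" 1] val_mult_less_1[OF dvd_2 that] by simp

lemma val_of_int_even: "even z \<Longrightarrow> v (of_int z) < 1"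
  using val_mult_less_1[OF dvd_2 val_of_int_le] by (auto elim!: evenE)

lemma val_of_int_odd: "odd z \<Longrightarrow> v (of_int z) = 1"
  using val_odd[OF val_of_int_le] by (auto elim!: oddE simp: add.commute)

text \<open>Odd integers are units, so only the factors 2 contribute to the value.\<close>

lemma val_of_int_power_2:
  assumes "z \<noteq> 0"
  shows "\<exists>n. v (of_int z) = v 2 ^ n"
  using assms
proof (induction "nat \<bar>z\<bar>" arbitrary: z rule: less_induct)
  case less
  show ?case
  proof (cases "even z")
    case True
    then obtain k where k: "z = 2 * k"
      by (rule evenE)
    then obtain n where "v (of_int k) = v 2 ^ n"
      using less by fastforce
    then have "v (of_int z) = v 2 ^ Suc n"
      by (simp add: k mult)
    then show ?thesis
      by blast
  next
    case False
    then have "v (of_int z) = v 2 ^ 0"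
      by (simp add: val_of_int_odd)
    then show ?thesis
      by blast
  qed
qed

end

section \<open>Sums of squares in dyadic local fields\<close>

text \<open>The finiteness of the residue field and the discreteness of the value group are stated
  through representatives and a real base \<open>\<rho>\<close>, the forms in which they pass from a dense subfield.\<close>

locale dyadic_field = dyadic_place v for v :: "'a :: field \<Rightarrow> real" +
  assumes two_nonzero: "(2 :: 'a) \<noteq> 0"
    and complete: "Metric_space.mcomplete UNIV (val_dist v)"
    and finite_residue_field: "\<exists>R. finite R \<and> (\<forall>x. v x \<le> 1 \<longrightarrow> (\<exists>r\<in>R. v (x - r) < 1))"
    and discrete: "\<exists>\<rho>. 0 < \<rho> \<and> \<rho> < 1 \<and> (\<forall>x. x \<noteq> 0 \<longrightarrow> (\<exists>z :: int. v x = \<rho> powi z))"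
begin

section \<open>Artin-Schreier equations and the local square theorem\<close>

lemma four_nonzero: "(4 :: 'a) \<noteq> 0"
  using two_nonzero by (metis mult_eq_0_iff numeral_Bit0 mult_2)

text \<open>A root is a fixed point of y -> x - y^2, which contracts the ball of radius
  \<open>v x\<close> by the factor \<open>v x\<close>, since y^2 - z^2 = (y + z)(y - z).\<close>

lemma artin_schreier_root:
  assumes x: "v x < 1"
  obtains y where "y\<^sup>2 + y = x"
proof -
  have nonneg_v: "0 \<le> v y" for y
    by (rule nonneg)
  interpret Metric_space UNIV "val_dist v"
    by (rule Metric_space_val_dist)
  \<comment> \<open>The constant branch extends the map to the whole complete space and keeps the
    contraction: for y inside and z outside the ball, \<open>v (y - z) = v z\<close>. Its value x
    lies in the ball, hence so does the fixed point.\<close>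
  define f where "f y = (if v y \<le> v x then x - y\<^sup>2 else x)" for y
  have contraction: "v (f y - f z) \<le> v x * v (y - z)" if yz: "v y \<le> v x" for y z
  proof (cases "v z \<le> v x")
    case True
    have "v (y + z) \<le> v x"
      using yz True by (rule val_add_le)
    moreover have "f y - f z = (y + z) * (z - y)"
      using yz True by (simp add: f_def power2_eq_square algebra_simps)
    ultimately show ?thesis
      using mult_right_mono[of "v (y + z)" "v x" "v (y - z)"]
      by (simp add: mult nonneg_v val_minus_commute[of z])
  next
    case False
    then have "v (y - z) = v z"
      using val_add_eq[of y "- z"] yz by simp
    then have "v y * v y \<le> v x * v (y - z)"
      using yz False by (intro mult_mono) (auto simp: nonneg_v)
    then show ?thesis
      using yz False by (simp add: f_def power2_eq_square mult)
  qed
  have "val_dist v (f y) (f z) \<le> v x * val_dist v y z" for y z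
  proof (cases "v y \<le> v x \<or> v z \<le> v x")
    case True
    then show ?thesis
      using contraction[of y z] contraction[of z y]
      by (auto simp: val_dist_def val_minus_commute[of "f y"] val_minus_commute[of y])
  next
    case False
    then show ?thesis
      by (simp add: val_dist_def f_def nonneg_v)
  qed
  then obtain y where y: "f y = y"
    using Banach_fixedpoint_thm[OF complete, of f "v x"] x by auto
  have "v y \<le> v x"
    using y by (metis f_def order_refl)
  then have "y\<^sup>2 + y = x"
    using y unfolding f_def by (metis add.commute diff_add_cancel)
  then show thesis ..
qed

text \<open>The local square theorem: as (1 + 2y)^2 = 1 + 4(y^2 + y), it suffices to write a / s^2 =
  1 + 4x and to solve y^2 + y = x.\<close>

lemma is_square_if_close:
  assumes s: "s \<noteq> 0" and close: "v (a - s\<^sup>2) < v 4 * v (s\<^sup>2)"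
  shows "is_square a"
proof -
  define x where "x = (a - s\<^sup>2) / (4 * s\<^sup>2)"
  have "v x < 1"
    using close s four_nonzero by (simp add: x_def val_divide mult divide_less_eq val_pos_iff)
  then obtain y where "y\<^sup>2 + y = x"
    by (rule artin_schreier_root)
  then have "(s * (1 + 2 * y))\<^sup>2 = s\<^sup>2 * (1 + 4 * x)"
    by (auto simp: power2_eq_square algebra_simps)
  also have "\<dots> = a"
    using s four_nonzero by (simp add: x_def field_simps)
  finally show ?thesis
    unfolding is_nth_power_def by metis
qed

section \<open>The finite residue field\<close>

text \<open>On integral elements \<open>rep\<close> is constant exactly on residue classes, so its
  image is a finite model of the residue field in which classes can be counted.\<close>

lemma residue_representatives:
  obtains rep :: "'a \<Rightarrow> 'a" where
    "finite (rep ` {x. v x \<le> 1})"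
    "\<And>x. v x \<le> 1 \<Longrightarrow> v (rep x) \<le> 1"
    "\<And>x. v x \<le> 1 \<Longrightarrow> v (x - rep x) < 1"
    "\<And>x y. v x \<le> 1 \<Longrightarrow> v y \<le> 1 \<Longrightarrow> rep x = rep y \<longleftrightarrow> v (x - y) < 1"
proof -
  obtain R where R: "finite R" "\<And>x. v x \<le> 1 \<Longrightarrow> \<exists>r\<in>R. v (x - r) < 1"
    using finite_residue_field by blast
  \<comment> \<open>The members of R congruent to x label the residue class of x, and R has only
    finitely many subsets.\<close>
  define cls where "cls x = {r \<in> R. v (x - r) < 1}" for x
  define pick where "pick X = (SOME x. v x \<le> 1 \<and> cls x = X)" for X
  have cls_eq: "cls x = cls y \<longleftrightarrow> v (x - y) < 1" if x: "v x \<le> 1" and y: "v y \<le> 1" for x y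
  proof
    assume eq: "cls x = cls y"
    obtain r where "r \<in> cls x"
      using R(2)[OF x] by (auto simp: cls_def)
    then have "v (x - r) < 1" "v (r - y) < 1"
      using eq by (auto simp: cls_def val_minus_commute[of _ y])
    then show "v (x - y) < 1"
      by (rule val_congruent_trans)
  next
    assume "v (x - y) < 1"
    then show "cls x = cls y"
      using val_congruent_trans[of x y 1] val_congruent_trans[of y x 1]
      by (auto simp: cls_def val_minus_commute[of y x])
  qed
  have pick: "v (pick (cls x)) \<le> 1 \<and> cls (pick (cls x)) = cls x" if "v x \<le> 1" for x
    unfolding pick_def by (rule someI[where x = x]) (simp add: that)
  show thesis
  proof
    show "finite ((\<lambda>x. pick (cls x)) ` {x. v x \<le> 1})"
      using finite_surj[of "Pow R" "(\<lambda>x. pick (cls x)) ` {x. v x \<le> 1}" pick] R(1)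
      by (auto simp: cls_def)
    show "v (pick (cls x)) \<le> 1" if "v x \<le> 1" for x
      using pick[OF that] ..
    show "v (x - pick (cls x)) < 1" if "v x \<le> 1" for x
      using pick[OF that] cls_eq that by metis
    show "pick (cls x) = pick (cls y) \<longleftrightarrow> v (x - y) < 1" if "v x \<le> 1" "v y \<le> 1" for x y
      using pick cls_eq that by metis
  qed
qed

text \<open>Squaring is injective on a finite field of characteristic 2, hence surjective.\<close>

lemma residue_sqrt:
  assumes x: "v x \<le> 1"
  obtains s where "v (x - s\<^sup>2) < 1"
proof -
  obtain rep where rep: "finite (rep ` {x. v x \<le> 1})"
    "\<And>x. v x \<le> 1 \<Longrightarrow> v (rep x) \<le> 1"
    "\<And>x. v x \<le> 1 \<Longrightarrow> v (x - rep x) < 1"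
    "\<And>x y. v x \<le> 1 \<Longrightarrow> v y \<le> 1 \<Longrightarrow> rep x = rep y \<longleftrightarrow> v (x - y) < 1"
    using residue_representatives by blast
  define T where "T = rep ` {x. v x \<le> 1}"
  have T_le: "v r \<le> 1" if "r \<in> T" for r
    using that rep(2) by (auto simp: T_def)
  have rep_T: "rep r = r" if "r \<in> T" for r
    using that rep(2,3,4) by (auto simp: T_def val_minus_commute)
  have sq_le: "v (r\<^sup>2) \<le> 1" if "r \<in> T" for r
    using T_le[OF that] by (simp add: power2_eq_square val_mult_le_1)
  have "inj_on (\<lambda>r. rep (r\<^sup>2)) T"
  proof (rule inj_onI)
    fix r s
    assume r: "r \<in> T" and s: "s \<in> T" and "rep (r\<^sup>2) = rep (s\<^sup>2)"
    then have "v (r\<^sup>2 - s\<^sup>2) < 1"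
      using rep(4) sq_le by blast
    \<comment> \<open>The error in the congruence of r^2 - s^2 with (r - s)^2 modulo 2.\<close>
    moreover have "v (2 * (s * (r - s))) < 1"
      using T_le[OF r] T_le[OF s] val_diff_le[of r s]
      by (intro val_mult_less_1 dvd_2 val_mult_le_1) auto
    ultimately have "v ((r\<^sup>2 - s\<^sup>2) - 2 * (s * (r - s))) < 1"
      by (rule val_diff_less)
    also have "(r\<^sup>2 - s\<^sup>2) - 2 * (s * (r - s)) = (r - s)\<^sup>2"
      by (simp add: power2_eq_square algebra_simps)
    finally have "v (r - s) < 1"
      by (rule val_power2_less_1D)
    then show "r = s"
      using rep(4) rep_T r s T_le by metis
  qed
  moreover have "(\<lambda>r. rep (r\<^sup>2)) ` T \<subseteq> T"
    using sq_le by (auto simp: T_def)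
  ultimately have "(\<lambda>r. rep (r\<^sup>2)) ` T = T"
    using rep(1) by (intro endo_inj_surj) (auto simp: T_def)
  moreover have "rep x \<in> T"
    using x by (simp add: T_def)
  ultimately obtain r where "r \<in> T" "rep x = rep (r\<^sup>2)"
    by blast
  then have "v (x - r\<^sup>2) < 1"
    using rep(4) x sq_le by blast
  then show thesis ..
qed

text \<open>The class of c lies in the image of the Artin-Schreier map of the residue field,
  expressed through integral lifts.\<close>

definition artin_schreier_residue :: "'a \<Rightarrow> bool" where
  "artin_schreier_residue c \<longleftrightarrow> (\<exists>x. v x \<le> 1 \<and> v (x\<^sup>2 + x - c) < 1)"

lemma artin_schreier_residue_cong:
  assumes "artin_schreier_residue c" "v (c - d) < 1"
  shows "artin_schreier_residue d"
  using assms val_congruent_trans unfolding artin_schreier_residue_def by blast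

text \<open>In characteristic 2 the Artin-Schreier map is additive, so differences of its values are
  values again.\<close>

lemma artin_schreier_residue_diff:
  assumes r: "v r \<le> 1" and s: "v s \<le> 1"
  shows "artin_schreier_residue (r\<^sup>2 + r - (s\<^sup>2 + s))"
proof -
  have "v (2 * (s * (s - r))) < 1"
    using r s val_diff_le[of s r] by (intro val_mult_less_1 dvd_2 val_mult_le_1) auto
  also have "2 * (s * (s - r)) = (r - s)\<^sup>2 + (r - s) - (r\<^sup>2 + r - (s\<^sup>2 + s))"
    by (simp add: power2_eq_square algebra_simps)
  finally show ?thesis
    using r s val_diff_le[of r s] unfolding artin_schreier_residue_def
    by (intro exI[of _ "r - s"]) auto
qed

text \<open>The Artin--Schreier map of the finite residue field has kernel \<open>{0, 1}\<close>, so its image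
  has index 2; three distinct cosets of the image would not fit into the residue field.\<close>

lemma artin_schreier_residue_index:
  assumes c: "v c \<le> 1" and d: "v d \<le> 1"
  shows "artin_schreier_residue c \<or> artin_schreier_residue d \<or> artin_schreier_residue (c - d)"
proof (rule ccontr)
  assume neg: "\<not> ?thesis"
  obtain rep where rep: "finite (rep ` {x. v x \<le> 1})"
    "\<And>x. v x \<le> 1 \<Longrightarrow> v (rep x) \<le> 1"
    "\<And>x. v x \<le> 1 \<Longrightarrow> v (x - rep x) < 1"
    "\<And>x y. v x \<le> 1 \<Longrightarrow> v y \<le> 1 \<Longrightarrow> rep x = rep y \<longleftrightarrow> v (x - y) < 1"
    using residue_representatives by blast
  define T where "T = rep ` {x. v x \<le> 1}"
  define \<phi> where "\<phi> x = x\<^sup>2 + x" for x :: 'a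
  define A where "A = (\<lambda>x. rep (\<phi> x)) ` T"
  have fin: "finite T" "finite A"
    using rep(1) by (auto simp: T_def A_def)
  have T_le: "v r \<le> 1" if "r \<in> T" for r
    using that rep(2) by (auto simp: T_def)
  have rep_T: "rep r = r" if "r \<in> T" for r
    using that rep(2,3,4) by (auto simp: T_def val_minus_commute)
  have \<phi>_le: "v (\<phi> r) \<le> 1" if "v r \<le> 1" for r
    using that by (auto simp: \<phi>_def power2_eq_square intro!: val_add_le val_mult_le_1)
  have A_T: "A \<subseteq> T"
  proof
    fix y assume "y \<in> A"
    then obtain r where "r \<in> T" "y = rep (\<phi> r)"
      unfolding A_def by blast
    moreover have "v (\<phi> r) \<le> 1"
      using \<phi>_le T_le \<open>r \<in> T\<close> by blast
    ultimately show "y \<in> T"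
      unfolding T_def by blast
  qed
  define g where "g = inv_into T (\<lambda>x. rep (\<phi> x))"
  \<comment> \<open>\<open>g\<close> picks one preimage s of each value, and any other preimage is
    congruent to s + 1. Hence |T| <= 2|A|.\<close>
  have "T \<subseteq> g ` A \<union> (\<lambda>y. rep (g y + 1)) ` A"
  proof
    fix r assume r: "r \<in> T"
    define s where "s = g (rep (\<phi> r))"
    have rA: "rep (\<phi> r) \<in> A"
      using r by (simp add: A_def)
    have s: "s \<in> T" "rep (\<phi> s) = rep (\<phi> r)"
      unfolding s_def g_def using rA unfolding A_def
      by (rule inv_into_into, rule f_inv_into_f[where f = "\<lambda>x. rep (\<phi> x)"])
    have "v (r - s) < 1 \<or> v (r - (s + 1)) < 1"
    proof -
      \<comment> \<open>Modulo 2 the difference is (r - s)(r - (s + 1)), so one of these factors has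
        value below 1.\<close>
      have "v (\<phi> r - \<phi> s) < 1"
        using s rep(4) \<phi>_le T_le r by metis
      moreover have "v (2 * (r - s)) < 1"
        using T_le[OF r] T_le[OF s(1)] val_diff_le[of r s] by (intro val_mult_less_1 dvd_2) auto
      moreover have "v (2 * (s * (r - s))) < 1"
        using T_le[OF r] T_le[OF s(1)] val_diff_le[of r s]
        by (intro val_mult_less_1 dvd_2 val_mult_le_1) auto
      ultimately have "v (\<phi> r - \<phi> s - 2 * (r - s) - 2 * (s * (r - s))) < 1"
        by (blast intro: val_diff_less)
      also have "\<phi> r - \<phi> s - 2 * (r - s) - 2 * (s * (r - s)) = (r - s) * (r - (s + 1))"
        by (simp add: \<phi>_def power2_eq_square algebra_simps)
      finally show ?thesis
        using mult_mono[of 1 "v (r - s)" 1 "v (r - (s + 1))"] nonneg[of "r - s"]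
        unfolding mult by argo
    qed
    moreover have "v (s + 1) \<le> 1"
      using T_le[OF s(1)] by (intro val_add_le) auto
    ultimately have "r = s \<or> r = rep (s + 1)"
      using rep(4) rep_T r s(1) T_le by metis
    then show "r \<in> g ` A \<union> (\<lambda>y. rep (g y + 1)) ` A"
      using rA by (auto simp: s_def)
  qed
  then have "card T \<le> card (g ` A \<union> (\<lambda>y. rep (g y + 1)) ` A)"
    using fin by (intro card_mono) auto
  also have "\<dots> \<le> card (g ` A) + card ((\<lambda>y. rep (g y + 1)) ` A)"
    by (rule card_Un_le)
  also have "\<dots> \<le> card A + card A"
    using fin by (intro add_mono card_image_le)
  finally have upper: "card T \<le> card A + card A" .
  \<comment> \<open>The coset of the image through e. The negated claim makes the cosets of 0, c and
    d disjoint, so 3|A| <= |T| <= 2|A| and A is empty, which is absurd.\<close>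
  define B where "B e = (\<lambda>y. rep (y + e)) ` A" for e
  have card_B: "card (B e) = card A" and B_T: "B e \<subseteq> T" if e: "v e \<le> 1" for e
  proof -
    have le: "v (y + e) \<le> 1" if "y \<in> A" for y
      using that A_T T_le e by (intro val_add_le) auto
    have "inj_on (\<lambda>y. rep (y + e)) A"
    proof (rule inj_onI)
      fix y z assume yz: "y \<in> A" "z \<in> A" "rep (y + e) = rep (z + e)"
      then have "v (y + e - (z + e)) < 1"
        using rep(4) le by blast
      then have "rep y = rep z"
        using rep(4) T_le A_T yz(1,2) by auto
      then show "y = z"
        using rep_T A_T yz(1,2) by (metis subsetD)
    qed
    then show "card (B e) = card A"
      by (simp add: B_def card_image)
    show "B e \<subseteq> T"
      unfolding B_def T_def using le by blast
  qed
  have disj: "B e \<inter> B e' = {}"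
    if e: "v e \<le> 1" "v e' \<le> 1" and "\<not> artin_schreier_residue (e - e')" for e e'
  proof (rule ccontr)
    assume "B e \<inter> B e' \<noteq> {}"
    then obtain r s where rs: "r \<in> T" "s \<in> T" "rep (rep (\<phi> r) + e) = rep (rep (\<phi> s) + e')"
      by (auto simp: B_def A_def)
    have le: "v (rep (\<phi> r) + e) \<le> 1" "v (rep (\<phi> s) + e') \<le> 1"
      using rs T_le \<phi>_le rep(2) e by (auto intro!: val_add_le)
    have "v (rep (\<phi> r) + e - (rep (\<phi> s) + e')) < 1"
      using rep(4)[OF le] rs(3) by blast
    moreover have "v (\<phi> r - rep (\<phi> r)) < 1" "v (\<phi> s - rep (\<phi> s)) < 1"
      using rs T_le \<phi>_le rep(3) by auto
    ultimately have "v ((\<phi> s - rep (\<phi> s)) - (\<phi> r - rep (\<phi> r)) - (rep (\<phi> r) + e - (rep (\<phi> s) + e'))) < 1"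
      by (blast intro: val_diff_less)
    moreover have "(\<phi> s - rep (\<phi> s)) - (\<phi> r - rep (\<phi> r)) - (rep (\<phi> r) + e - (rep (\<phi> s) + e')) =
      s\<^sup>2 + s - (r\<^sup>2 + r) - (e - e')"
      by (simp add: \<phi>_def)
    ultimately show False
      using artin_schreier_residue_cong artin_schreier_residue_diff[of s r] T_le rs that(3) by metis
  qed
  have zero: "\<not> artin_schreier_residue (0 - c)" "\<not> artin_schreier_residue (0 - d)"
  proof -
    have *: "artin_schreier_residue e" if "artin_schreier_residue (0 - e)" "v e \<le> 1" for e
    proof (rule artin_schreier_residue_cong)
      have "v (2 * - e) < 1"
        using that(2) by (intro val_mult_less_1 dvd_2) simp
      also have "2 * - e = 0 - e - e"
        by simp
      finally show "v (0 - e - e) < 1" .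
    qed (rule that)
    show "\<not> artin_schreier_residue (0 - c)" "\<not> artin_schreier_residue (0 - d)"
      using *[of c] *[of d] c d neg by auto
  qed
  have "card A + card A + card A = card (B 0) + card (B c) + card (B d)"
    using card_B c d by simp
  also have "\<dots> = card (B 0 \<union> B c) + card (B d)"
    using disj[of 0 c] zero c fin by (simp add: card_Un_disjoint B_def)
  also have "\<dots> = card (B 0 \<union> B c \<union> B d)"
    using disj[of 0 d] disj[of c d] zero c d fin neg
    by (subst card_Un_disjoint) (auto simp: B_def)
  also have "\<dots> \<le> card T"
    using fin B_T c d by (intro card_mono Un_least) auto
  finally have "card A = 0"
    using upper by linarith
  moreover have "rep 0 \<in> T"
    by (auto simp: T_def)
  ultimately show False
    using fin by (auto simp: A_def)
qed

text \<open>If c is congruent to x^2 + x, then the unit square (1 + 2x)^2 is closer to 1 + 4c than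
  \<open>v 4\<close>.\<close>

lemma is_square_1_plus_4:
  assumes "artin_schreier_residue c"
  shows "is_square (1 + 4 * c)"
proof -
  obtain x where x: "v x \<le> 1" "v (x\<^sup>2 + x - c) < 1"
    using assms unfolding artin_schreier_residue_def by blast
  have unit: "v (1 + 2 * x) = 1"
    using x(1) by (rule val_odd)
  have "(1 + 4 * c) - (1 + 2 * x)\<^sup>2 = - (4 * (x\<^sup>2 + x - c))"
    by (simp add: power2_eq_square algebra_simps)
  moreover have "0 < v 4"
    using four_nonzero by (simp add: val_pos_iff)
  ultimately have "v ((1 + 4 * c) - (1 + 2 * x)\<^sup>2) < v 4 * v ((1 + 2 * x)\<^sup>2)"
    using x(2) by (simp only: val_minus mult val_power unit) simp
  moreover have "1 + 2 * x \<noteq> 0"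
    using unit by auto
  ultimately show ?thesis
    by (intro is_square_if_close)
qed

section \<open>Parity of order\<close>

text \<open>Even order with respect to a uniformizer, expressed without choosing one. It entails
  that c is nonzero.\<close>

definition even_val :: "'a \<Rightarrow> bool" where
  "even_val c \<longleftrightarrow> (\<exists>s. s \<noteq> 0 \<and> v c = v (s\<^sup>2))"

text \<open>The base given by \<open>discrete\<close> need not be a value itself. The least positive
  exponent that occurs divides all the others, by division with remainder; some positive exponent
  occurs because \<open>v 2 < 1\<close>.\<close>

lemma uniformizer:
  obtains p where "0 < v p" "v p < 1" "\<And>x. x \<noteq> 0 \<Longrightarrow> \<exists>z :: int. v x = v p powi z"
proof -
  obtain \<rho> where \<rho>: "0 < \<rho>" "\<rho> < 1" "\<And>x. x \<noteq> 0 \<Longrightarrow> \<exists>z :: int. v x = \<rho> powi z"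
    using discrete by blast
  define P where "P n \<longleftrightarrow> 0 < n \<and> (\<exists>x. v x = \<rho> ^ n)" for n
  obtain z :: int where z: "v 2 = \<rho> powi z"
    using \<rho>(3) two_nonzero by blast
  have "z > 0"
  proof (rule ccontr)
    assume "\<not> z > 0"
    then have "\<rho> powi z \<ge> 1"
      using \<rho>(1,2) by (simp add: power_int_def one_le_inverse power_le_one)
    then show False
      using z dvd_2 by simp
  qed
  then have "v 2 = \<rho> ^ nat z"
    using z by (simp add: power_int_def)
  then have "P (nat z)"
    using \<open>z > 0\<close> by (auto simp: P_def)
  define n where "n = (LEAST n. P n)"
  have "P n"
    unfolding n_def by (rule LeastI) fact
  then obtain p where n: "0 < n" and p: "v p = \<rho> ^ n"
    by (auto simp: P_def)
  have p_powi: "v p powi k = \<rho> powi (int n * k)" for k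
    by (simp add: p power_int_mult)
  show thesis
  proof
    show "0 < v p" "v p < 1"
      using \<rho>(1,2) n by (auto simp: p power_less_one_iff)
    fix x :: 'a assume "x \<noteq> 0"
    then obtain k :: int where k: "v x = \<rho> powi k"
      using \<rho>(3) by blast
    have "v (x / p powi (k div int n)) = \<rho> powi k / \<rho> powi (int n * (k div int n))"
      by (simp add: val_divide val_power_int p_powi k)
    also have "\<dots> = \<rho> powi (k mod int n)"
      using \<rho>(1) by (simp add: power_int_diff[symmetric] minus_mult_div_eq_mod)
    also have "\<dots> = \<rho> ^ nat (k mod int n)"
      using n by (simp add: power_int_def)
    finally have pow: "v (x / p powi (k div int n)) = \<rho> ^ nat (k mod int n)" .
    have "nat (k mod int n) < n"
      using n pos_mod_bound[of "int n" k] by linarith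
    then have "\<not> P (nat (k mod int n))"
      unfolding n_def by (rule not_less_Least)
    moreover have "\<exists>y. v y = \<rho> ^ nat (k mod int n)"
      using pow by (rule exI)
    ultimately have "\<not> 0 < nat (k mod int n)"
      by (simp add: P_def)
    then have "k = int n * (k div int n)"
      using n pos_mod_sign[of "int n" k] by (metis add.right_neutral mult_div_mod_eq of_nat_0_less_iff order_antisym zero_less_nat_eq not_less)
    then show "\<exists>z. v x = v p powi z"
      using k p_powi by metis
  qed
qed

text \<open>Two odd orders differ by an even one. As the base is the value of an element p, an even
  power of it is the value of a square.\<close>

lemma even_val_divide:
  assumes "x \<noteq> 0" "y \<noteq> 0" "\<not> even_val x" "\<not> even_val y"
  shows "even_val (x / y)"
proof -
  obtain p where p: "0 < v p" "\<And>x. x \<noteq> 0 \<Longrightarrow> \<exists>z :: int. v x = v p powi z"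
    using uniformizer by metis
  have even: "even_val x" if x: "v x = v p powi z" and "even z" for x and z :: int
  proof -
    obtain k where "z = k * 2"
      using \<open>even z\<close> by (metis evenE mult.commute)
    then have "v x = v ((p powi k)\<^sup>2)"
      using x by (simp add: val_power val_power_int power_int_mult)
    moreover have "p powi k \<noteq> 0"
      using p(1) by (simp add: val_pos_iff)
    ultimately show ?thesis
      unfolding even_val_def by blast
  qed
  obtain i j :: int where ij: "v x = v p powi i" "v y = v p powi j"
    using p(2) assms by metis
  then have "odd i" "odd j"
    using even assms by blast+
  moreover have "v (x / y) = v p powi (i - j)"
    using p(1) ij by (simp add: val_divide power_int_diff)
  ultimately show ?thesis
    using even by simp
qed

text \<open>Between \<open>\<delta>\<close> and the value of one member of S lie only finitely many
  powers of \<open>v p\<close>.\<close>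

lemma val_min_attained:
  assumes "S \<noteq> {}" "0 < \<delta>" "\<And>x. x \<in> S \<Longrightarrow> \<delta> \<le> v x"
  obtains x where "x \<in> S" "\<And>y. y \<in> S \<Longrightarrow> v x \<le> v y"
proof -
  obtain p where p: "0 < v p" "v p < 1" "\<And>x. x \<noteq> 0 \<Longrightarrow> \<exists>z :: int. v x = v p powi z"
    using uniformizer by metis
  obtain x0 where x0: "x0 \<in> S"
    using assms(1) by blast
  define S' where "S' = {x \<in> S. v x \<le> v x0}"
  obtain n where n: "v p ^ n < \<delta>"
    using real_arch_pow_inv[OF assms(2) p(2)] by blast
  obtain m where m: "v p ^ m < 1 / v x0"
    using real_arch_pow_inv[OF _ p(2), of "1 / v x0"] assms(2) assms(3)[OF x0] by auto
  have "v ` S' \<subseteq> (\<lambda>z. v p powi z) ` {- int m..int n}"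
  proof
    fix r assume "r \<in> v ` S'"
    then obtain x where x: "x \<in> S" "v x \<le> v x0" "r = v x"
      by (auto simp: S'_def)
    then have "x \<noteq> 0"
      using assms(2) assms(3)[of x] by auto
    then obtain z :: int where z: "v x = v p powi z"
      using p(3) by blast
    have anti: "v p powi j \<le> v p powi i" if "i \<le> j" for i j :: int
      using p that by (simp add: power_int_decreasing)
    have "z \<le> int n"
    proof (rule ccontr)
      assume "\<not> ?thesis"
      then have "v x \<le> v p ^ n"
        using anti[of "int n" z] z by simp
      then show False
        using n assms(3)[OF x(1)] by simp
    qed
    moreover have "- int m \<le> z"
    proof (rule ccontr)
      assume "\<not> ?thesis"
      then have "inverse (v p ^ m) \<le> v x"
        using anti[of z "- int m"] z by (simp add: power_int_minus)
      moreover have "v x0 < inverse (v p ^ m)"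
        using m p(1) assms(2) assms(3)[OF x0] by (simp add: field_simps)
      ultimately show False
        using x(2) by simp
    qed
    ultimately show "r \<in> (\<lambda>z. v p powi z) ` {- int m..int n}"
      using z x(3) by auto
  qed
  then have fin: "finite (v ` S')"
    by (rule finite_subset) simp
  moreover have ne: "v ` S' \<noteq> {}"
    using x0 by (auto simp: S'_def)
  ultimately have "Min (v ` S') \<in> v ` S'"
    by (rule Min_in)
  then obtain x where x: "x \<in> S'" "v x = Min (v ` S')"
    by auto
  show thesis
  proof
    show "x \<in> S"
      using x by (simp add: S'_def)
    fix y assume "y \<in> S"
    show "v x \<le> v y"
    proof (cases "y \<in> S'")
      case True
      then show ?thesis
        using fin x(2) by simp
    next
      case False
      then show ?thesis
        using \<open>y \<in> S\<close> x(1) by (simp add: S'_def)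
    qed
  qed
qed

section \<open>Representations by three and four squares\<close>

text \<open>Division by squares reduces c first to a unit and then, by \<open>residue_sqrt\<close>,
  to a unit congruent to 1; the latter is 1 + y + y^2 by \<open>artin_schreier_root\<close>.\<close>

lemma eisenstein_norm_represents:
  assumes "even_val c"
  obtains x y where "x\<^sup>2 + x * y + y\<^sup>2 = c"
proof -
  obtain s where s: "s \<noteq> 0" "v c = v (s\<^sup>2)"
    using assms unfolding even_val_def by blast
  define d where "d = c / s\<^sup>2"
  have d: "v d = 1" and c: "c = s\<^sup>2 * d"
    using s val_pos_iff[of "s\<^sup>2"] by (simp_all add: d_def val_divide)
  obtain r where r: "v (d - r\<^sup>2) < 1"
    using residue_sqrt[of d] d by auto
  then have "v (r\<^sup>2) = 1"
    using val_eq_of_close[of d "r\<^sup>2"] d by simp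
  then have "v (d / r\<^sup>2 - 1) < 1" and r0: "r \<noteq> 0"
    using r val_divide[of "d - r\<^sup>2" "r\<^sup>2"] by (auto simp: diff_divide_distrib split: if_splits)
  then obtain y where "y\<^sup>2 + y = d / r\<^sup>2 - 1"
    using artin_schreier_root by blast
  then have "d = r\<^sup>2 * (1 + y + y\<^sup>2)"
    using r0 by (simp add: field_simps)
  then have "(s * r)\<^sup>2 + (s * r) * (s * r * y) + (s * r * y)\<^sup>2 = c"
    by (simp add: c power2_eq_square algebra_simps)
  then show thesis ..
qed

text \<open>The form \<open>x\<^sup>2 + y\<^sup>2 + z\<^sup>2\<close> splits as \<open>3t\<^sup>2\<close> plus twice the norm form of the unramified
  extension by the cube roots of unity.\<close>

lemma sum_three_squares_if_even_val:
  assumes "even_val ((a - 3 * t\<^sup>2) / 2)"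
  shows "\<exists>x y z. a = x\<^sup>2 + y\<^sup>2 + z\<^sup>2"
proof -
  obtain x y where "x\<^sup>2 + x * y + y\<^sup>2 = (a - 3 * t\<^sup>2) / 2"
    using assms by (rule eisenstein_norm_represents)
  then have "a = 3 * t\<^sup>2 + 2 * (x\<^sup>2 + x * y + y\<^sup>2)"
    using two_nonzero by (simp add: field_simps)
  \<comment> \<open>The vector (x, y, - x - y) is orthogonal to (t, t, t).\<close>
  also have "\<dots> = (t + x)\<^sup>2 + (t + y)\<^sup>2 + (t - x - y)\<^sup>2"
    by (simp add: power2_eq_square algebra_simps)
  finally show ?thesis
    by blast
qed

lemma val_three: "v 3 = 1"
  using val_odd[of 1] by simp

lemma three_nonzero: "(3 :: 'a) \<noteq> 0"
  using val_three by auto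

text \<open>In a = h^2 - k^2 the coefficient -1 is replaced by a sum of two squares.\<close>

lemma sum_three_squares_if_minus_one:
  fixes a s t :: 'a
  assumes "s\<^sup>2 + t\<^sup>2 = - 1"
  shows "\<exists>x y z. a = x\<^sup>2 + y\<^sup>2 + z\<^sup>2"
proof -
  obtain h k where "a = h\<^sup>2 + - 1 * k\<^sup>2"
    using two_nonzero by (rule difference_of_two_squares)
  also have "\<dots> = h\<^sup>2 + (s\<^sup>2 + t\<^sup>2) * k\<^sup>2"
    by (simp only: assms)
  also have "\<dots> = h\<^sup>2 + (s * k)\<^sup>2 + (t * k)\<^sup>2"
    by (simp add: power_mult_distrib distrib_right)
  finally show ?thesis
    by blast
qed

text \<open>A primitive cube root of unity \<open>\<omega>\<close> yields \<open>- 1 = \<omega> + \<omega>\<^sup>2\<close>, where \<open>\<omega> = (\<omega>\<^sup>2)\<^sup>2\<close>.\<close>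

lemma sum_three_squares_if_minus_three:
  fixes a :: 'a
  assumes "is_square (- 3 :: 'a)"
  shows "\<exists>x y z. a = x\<^sup>2 + y\<^sup>2 + z\<^sup>2"
proof -
  obtain r :: 'a where r: "r\<^sup>2 = - 3"
    using assms unfolding is_nth_power_def by metis
  define \<omega> where "\<omega> = (r - 1) / 2"
  have "2 * \<omega> + 1 = r"
    using two_nonzero by (simp add: \<omega>_def right_diff_distrib diff_divide_distrib)
  then have "(2 * \<omega> + 1)\<^sup>2 = - 3"
    using r by simp
  moreover have "4 * (\<omega>\<^sup>2 + \<omega> + 1) = (2 * \<omega> + 1)\<^sup>2 + 3"
    by (simp add: power2_eq_square algebra_simps)
  ultimately have "4 * (\<omega>\<^sup>2 + \<omega> + 1) = 0"
    by simp
  then have "\<omega>\<^sup>2 + \<omega> + 1 = 0"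
    using four_nonzero by (simp only: mult_eq_0_iff) simp
  moreover have "\<omega>\<^sup>2 = (\<omega>\<^sup>2 + \<omega> + 1) - \<omega> - 1"
    by simp
  ultimately have \<omega>: "\<omega>\<^sup>2 = - \<omega> - 1"
    by simp
  have "(- \<omega> - 1)\<^sup>2 = \<omega>\<^sup>2 + 2 * \<omega> + 1"
    by (simp add: power2_eq_square algebra_simps)
  then have "(\<omega>\<^sup>2)\<^sup>2 + \<omega>\<^sup>2 = - 1"
    using \<omega> by simp
  then show ?thesis
    by (rule sum_three_squares_if_minus_one)
qed

text \<open>O'Meara's quadratic defect: choose \<open>t\<close> with \<open>v (b - t\<^sup>2)\<close> minimal. If this is \<open>v (p\<^sup>2)\<close> with
  \<open>v p > v 2\<close>, then replacing \<open>t\<close> by \<open>t + p * r\<close> improves it, where \<open>r\<^sup>2\<close> is congruent to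
  \<open>(b - t\<^sup>2) / p\<^sup>2\<close>; below \<open>v 4\<close> the local square theorem makes \<open>b\<close> a square.\<close>

lemma quadratic_defect:
  assumes b: "v b = 1" and nsq: "\<not> is_square b"
  obtains t where "b \<noteq> t\<^sup>2" "\<not> even_val (b - t\<^sup>2)"
    | t c where "v t = 1" "v c = 1" "b = t\<^sup>2 * (1 + 4 * c)"
proof -
  have four: "0 < v 4"
    using four_nonzero by (simp add: val_pos_iff)
  have two: "v 4 = v 2 * v 2"
    by (metis mult mult_2 numeral_Bit0)
  have nonsq: "b \<noteq> t\<^sup>2" for t
    using nsq unfolding is_nth_power_def by blast
  \<comment> \<open>A square closer to b would be a unit, and b a square by the local square
    theorem. The bound also ensures that the minimum is attained.\<close>
  have lower: "v 4 \<le> v (b - t\<^sup>2)" for t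
  proof (rule ccontr)
    assume close: "\<not> ?thesis"
    moreover have "v 4 \<le> 1"
      using val_of_nat_le[of 4] by simp
    ultimately have "v (t\<^sup>2) = 1"
      using val_eq_of_close[of b "t\<^sup>2"] b by simp
    moreover from this have "t \<noteq> 0"
      by auto
    ultimately show False
      using is_square_if_close[of t b] close nsq by simp
  qed
  obtain d where d: "d \<in> range (\<lambda>t. b - t\<^sup>2)"
    and "\<And>y. y \<in> range (\<lambda>t. b - t\<^sup>2) \<Longrightarrow> v d \<le> v y"
    using val_min_attained[of "range (\<lambda>t. b - t\<^sup>2)" "v 4"] lower four by blast
  then obtain t where min: "v (b - t\<^sup>2) \<le> v (b - s\<^sup>2)" for s
    by blast
  have "v (b - t\<^sup>2) \<le> 1"
    using min[of 0] b by simp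
  then have "v (b - (b - t\<^sup>2)) \<le> 1"
    using b val_diff_le[of b "b - t\<^sup>2"] by simp
  then have t_le: "v t \<le> 1"
    using power_le_one_iff[of "v t" 2] by (simp add: val_power nonneg)
  show thesis
  proof (cases "even_val (b - t\<^sup>2)")
    case False
    then show thesis
      using that(1) nonsq by blast
  next
    case True
    then obtain p where p: "p \<noteq> 0" "v (b - t\<^sup>2) = v (p\<^sup>2)"
      unfolding even_val_def by blast
    define c where "c = (b - t\<^sup>2) / p\<^sup>2"
    have c: "v c = 1" "b - t\<^sup>2 = p\<^sup>2 * c"
      using p val_pos_iff[of "p\<^sup>2"] by (simp_all add: c_def val_divide)
    obtain r where r: "v (c - r\<^sup>2) < 1"
      using residue_sqrt[of c] c by auto
    have "v (r\<^sup>2) = 1"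
      using val_eq_of_close[of c "r\<^sup>2"] c r by simp
    then have vr: "v r = 1"
      using power_eq_iff_eq_base[of 2 "v r" 1] by (simp add: val_power nonneg)
    have step: "v (p\<^sup>2) \<le> v (p\<^sup>2 * (c - r\<^sup>2) - p * r * (2 * t))"
    proof -
      have "b - (t + p * r)\<^sup>2 = (b - t\<^sup>2) - (p * r)\<^sup>2 - p * r * (2 * t)"
        by (simp add: power2_eq_square algebra_simps)
      also have "\<dots> = p\<^sup>2 * (c - r\<^sup>2) - p * r * (2 * t)"
        by (simp add: c(2) power_mult_distrib right_diff_distrib)
      finally show ?thesis
        using min[of "t + p * r"] p(2) by simp
    qed
    have vp: "0 < v p"
      using p(1) by (simp add: val_pos_iff)
    have "v (p\<^sup>2 * (c - r\<^sup>2)) < v (p\<^sup>2)"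
      using r vp by (simp add: mult val_power)
    \<comment> \<open>By minimality t + p r is no improvement on t, so the cross term has to be at
      least as large as p^2. This forces \<open>v p\<close> down to \<open>v 2\<close>, and
      \<open>lower\<close> gives equality.\<close>
    then have "v (p\<^sup>2) \<le> v (p * r * (2 * t))"
      using step val_diff_less[of "p\<^sup>2 * (c - r\<^sup>2)" "v (p\<^sup>2)" "p * r * (2 * t)"] by linarith
    then have "v p \<le> v 2 * v t"
      using vp vr by (simp add: mult val_power power2_eq_square)
    then have p_le: "v p \<le> v 2"
      using mult_left_le[of "v t" "v 2"] t_le nonneg[of 2] by linarith
    have "v 2 * v 2 \<le> v p * v p"
      using lower[of t] p(2) by (simp add: two mult power2_eq_square)
    then have vp2: "v p = v 2"
      using p_le power2_le_imp_le[of "v 2" "v p"] nonneg[of p] by (simp add: power2_eq_square)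
    then have "v t = 1"
      using \<open>v p \<le> v 2 * v t\<close> vp t_le by simp
    moreover define e where "e = (b / t\<^sup>2 - 1) / 4"
    have "t \<noteq> 0"
      using \<open>v t = 1\<close> by auto
    have "e = (b - t\<^sup>2) / (4 * t\<^sup>2)"
      using \<open>t \<noteq> 0\<close> by (simp add: e_def diff_divide_distrib)
    then have "v e = 1"
      using p(2) vp2 \<open>v t = 1\<close> two_nonzero
      by (simp add: eq_0_iff val_divide mult val_power power2_eq_square two)
    moreover have "4 * e = b / t\<^sup>2 - 1"
      by (simp only: e_def times_divide_eq_right nonzero_mult_div_cancel_left[OF four_nonzero])
    then have "b = t\<^sup>2 * (1 + 4 * e)"
      using \<open>t \<noteq> 0\<close> by simp
    ultimately show thesis
      by (rule that(2))
  qed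
qed

theorem sum_three_squares:
  fixes a :: 'a
  assumes a: "a \<noteq> 0" and nsq: "\<not> is_square (- a)"
  shows "\<exists>x y z. a = x\<^sup>2 + y\<^sup>2 + z\<^sup>2"
proof (cases "even_val 2")
  case True
  then obtain s where s: "s \<noteq> 0" "v 2 = v (s\<^sup>2)"
    unfolding even_val_def by blast
  obtain n where n: "v 2 ^ n < 1 / (v a + 1)"
    using real_arch_pow_inv[OF _ dvd_2, of "1 / (v a + 1)"] nonneg[of a] by auto
  \<comment> \<open>For this n, 3 t^2 dominates a, so a - 3 t^2 has the even order of t^2.\<close>
  define t :: 'a where "t = inverse (2 ^ n)"
  have t: "t \<noteq> 0"
    using two_nonzero by (simp add: t_def)
  have v2: "0 < v 2 ^ n" "v 2 ^ n \<le> 1"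
    using two_nonzero dvd_2 nonneg[of 2] by (simp_all add: val_pos_iff power_le_one)
  have vt: "v t = inverse (v 2 ^ n)"
    by (simp add: t_def val_inverse val_power)
  have "v a < v t"
    using n v2(1) nonneg[of a] by (simp add: vt field_simps)
  moreover have "1 \<le> v t"
    using v2 by (simp add: vt one_le_inverse)
  ultimately have "v a < v (3 * t\<^sup>2)"
    using self_le_power[of "v t" 2] by (simp add: mult val_three val_power)
  then have "v (a - 3 * t\<^sup>2) = v (t\<^sup>2)"
    using val_add_eq[of a "- (3 * t\<^sup>2)"] by (simp add: mult val_three val_minus_commute[of a])
  then have "v ((a - 3 * t\<^sup>2) / 2) = v ((t / s)\<^sup>2)"
    by (simp add: val_divide s(2) power_divide)
  then have "even_val ((a - 3 * t\<^sup>2) / 2)"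
    using s(1) t unfolding even_val_def by (metis divide_eq_0_iff)
  then show ?thesis
    by (rule sum_three_squares_if_even_val)
next
  case odd2: False
  show ?thesis
  proof (cases "even_val a")
    case False
    \<comment> \<open>Here t = 0 works, as a and 2 both have odd order.\<close>
    then have "even_val ((a - 3 * 0\<^sup>2) / 2)"
      using even_val_divide[OF a two_nonzero _ odd2] by simp
    then show ?thesis
      by (rule sum_three_squares_if_even_val)
  next
    case True
    then obtain s where s: "s \<noteq> 0" "v a = v (s\<^sup>2)"
      unfolding even_val_def by blast
    define b where "b = a / (3 * s\<^sup>2)"
    have b: "v b = 1" and a_eq: "a = 3 * s\<^sup>2 * b"
      using s three_nonzero val_pos_iff[of "s\<^sup>2"]
      by (simp_all add: b_def val_divide mult val_three)
    show ?thesis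
    proof (cases "is_square b")
      case True
      then obtain t where t: "b = t\<^sup>2"
        unfolding is_nth_power_def by blast
      have "a = (s * t)\<^sup>2 + (s * t)\<^sup>2 + (s * t)\<^sup>2"
        by (simp add: a_eq t power_mult_distrib)
      then show ?thesis
        by blast
    next
      case False
      with b show ?thesis
      proof (cases rule: quadratic_defect)
        case (1 t)
        \<comment> \<open>The factor s undoes the normalisation from a to b, so d has the odd order
          of b - t^2 up to an even summand.\<close>
        define d where "d = a - 3 * (s * t)\<^sup>2"
        have d: "d = 3 * s\<^sup>2 * (b - t\<^sup>2)"
          by (simp add: d_def a_eq power_mult_distrib algebra_simps)
        have "\<not> even_val d"
        proof
          assume "even_val d"
          then obtain u where u: "u \<noteq> 0" "v d = v (u\<^sup>2)"
            unfolding even_val_def by blast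
          have "v d = v (s\<^sup>2) * v (b - t\<^sup>2)"
            by (simp add: d mult val_three)
          then have "v (b - t\<^sup>2) = v ((u / s)\<^sup>2)"
            using s(1) u(2) by (simp add: val_divide power_divide eq_0_iff field_simps)
          then show False
            using 1(2) u(1) s(1) unfolding even_val_def by (metis divide_eq_0_iff)
        qed
        moreover have "d \<noteq> 0"
          using d 1(1) s(1) three_nonzero by simp
        ultimately have "even_val (d / 2)"
          using even_val_divide two_nonzero odd2 by blast
        then show ?thesis
          unfolding d_def by (rule sum_three_squares_if_even_val)
      next
        case (2 t c)
        \<comment> \<open>The number -1 is chosen because 1 + 4(-1) = -3. The three cases make b, -3
          or -3b a square.\<close>
        consider "artin_schreier_residue c" | "artin_schreier_residue (- 1)"
          | "artin_schreier_residue (c - (- 1))"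
          using artin_schreier_residue_index[of c "- 1"] 2(2) by auto
        then show ?thesis
        proof cases
          case 1
          then have "is_square b"
            unfolding 2(3) by (intro is_nth_power_mult is_square_1_plus_4) auto
          with False show ?thesis ..
        next
          case 2
          have "is_square (- 3 :: 'a)"
            using is_square_1_plus_4[OF 2] by simp
          then show ?thesis
            by (rule sum_three_squares_if_minus_three)
        next
          case 3
          \<comment> \<open>Modulo 2, c + 1 is congruent to -1 - 3c, and 1 + 4(-1 - 3c) = -3(1 +
            4c).\<close>
          have "v (2 * (1 + 2 * c)) < 1"
            using 2(2) by (intro val_mult_less_1 dvd_2) (simp add: val_odd)
          moreover have "c - (- 1) - (- 1 - 3 * c) = 2 * (1 + 2 * c)"
            by simp
          ultimately have "artin_schreier_residue (- 1 - 3 * c)"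
            using artin_schreier_residue_cong[OF 3] by simp
          then have "is_square (1 + 4 * (- 1 - 3 * c))"
            by (rule is_square_1_plus_4)
          then have "is_square ((s * t)\<^sup>2 * (1 + 4 * (- 1 - 3 * c)))"
            by (intro is_nth_power_mult) auto
          moreover have "(s * t)\<^sup>2 * (1 + 4 * (- 1 - 3 * c)) = - a"
            by (simp add: a_eq 2(3) power_mult_distrib algebra_simps)
          ultimately show ?thesis
            using nsq by simp
        qed
      qed
    qed
  qed
qed

text \<open>-7 = 1 + 4(-2) is a square because -2 reduces to 0. So a is 7 times a square, and 7 = 4
  + 1 + 1 + 1.\<close>

lemma minus_square_sum_four_squares:
  fixes a :: 'a
  assumes "is_square (- a)"
  shows "\<exists>x y z w. a = x\<^sup>2 + y\<^sup>2 + z\<^sup>2 + w\<^sup>2"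
proof -
  have "v (0\<^sup>2 + 0 - (- 2)) < 1"
    using dvd_2 by simp
  then have "artin_schreier_residue (- 2)"
    unfolding artin_schreier_residue_def by (intro exI[of _ 0]) simp
  then have "is_square (- 7 :: 'a)"
    using is_square_1_plus_4[of "- 2"] by simp
  then obtain q :: 'a where q: "q\<^sup>2 = - 7"
    unfolding is_nth_power_def by metis
  have "v 7 = 1"
    using val_odd[of 3] val_three by simp
  then have "q \<noteq> 0"
    using q by auto
  obtain r where r: "- a = r\<^sup>2"
    using assms unfolding is_nth_power_def by blast
  define u where "u = r / q"
  have "a = 7 * u\<^sup>2"
    using r q \<open>v 7 = 1\<close> by (auto simp: u_def power_divide) (metis minus_minus)
  then have "a = (2 * u)\<^sup>2 + u\<^sup>2 + u\<^sup>2 + u\<^sup>2"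
    by (simp add: power_mult_distrib)
  then show ?thesis
    by blast
qed

end

section \<open>The length\<close>

text \<open>Shorter sums are padded with zeros, so a bound n amounts to a sum of exactly n
  squares.\<close>

lemma sos_length_le_iff:
  fixes a :: "'a :: field"
  shows "sos_length a \<le> enat n \<longleftrightarrow> (\<exists>f. a = (\<Sum>i<n. (f i)\<^sup>2))"
proof
  define S where "S = {enat n | n. \<exists>f :: nat \<Rightarrow> 'a. a = (\<Sum>i<n. (f i)\<^sup>2)}"
  assume le: "sos_length a \<le> enat n"
  moreover have eq: "sos_length a = Inf S"
    unfolding sos_length_def S_def ..
  ultimately have "S \<noteq> {}"
    by (auto simp: Inf_enat_def)
  then have "Inf S \<in> S"
    unfolding Inf_enat_def by (auto intro: LeastI)
  then obtain m f where m: "sos_length a = enat m" "a = (\<Sum>i<m. (f i)\<^sup>2)"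
    unfolding eq by (auto simp: S_def)
  have "(\<Sum>i<n. (if i < m then f i else 0)\<^sup>2) = (\<Sum>i<m. (f i)\<^sup>2)"
    using le m(1) by (intro sum.mono_neutral_cong_right) auto
  then show "\<exists>f. a = (\<Sum>i<n. (f i)\<^sup>2)"
    using m(2) by metis
next
  assume "\<exists>f. a = (\<Sum>i<n. (f i)\<^sup>2)"
  then show "sos_length a \<le> enat n"
    unfolding sos_length_def by (intro Inf_lower) blast
qed

lemma sos_length_eqI:
  assumes "sos_length a \<le> enat (Suc n)" "\<not> sos_length a \<le> enat n"
  shows "sos_length a = enat (Suc n)"
  using assms by (cases "sos_length a") auto

text \<open>Iterated, this turns the bounds 1 to 4 into explicit equations.\<close>

lemma sos_length_le_Suc_iff:
  fixes a :: "'a :: field"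
  shows "sos_length a \<le> enat (Suc n) \<longleftrightarrow> (\<exists>x. sos_length (a - x\<^sup>2) \<le> enat n)"
proof
  assume "sos_length a \<le> enat (Suc n)"
  then obtain f where "a = (\<Sum>i<Suc n. (f i)\<^sup>2)"
    unfolding sos_length_le_iff by blast
  then have "a - (f n)\<^sup>2 = (\<Sum>i<n. (f i)\<^sup>2)"
    by simp
  then show "\<exists>x. sos_length (a - x\<^sup>2) \<le> enat n"
    unfolding sos_length_le_iff by blast
next
  assume "\<exists>x. sos_length (a - x\<^sup>2) \<le> enat n"
  then obtain x f where "a - x\<^sup>2 = (\<Sum>i<n. (f i)\<^sup>2)"
    unfolding sos_length_le_iff by blast
  then have "a = (\<Sum>i<Suc n. ((f(n := x)) i)\<^sup>2)"
    by (simp add: diff_eq_eq)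
  then show "sos_length a \<le> enat (Suc n)"
    unfolding sos_length_le_iff by blast
qed

lemma sos_length_le_0_iff: "sos_length a \<le> enat 0 \<longleftrightarrow> a = 0"
  by (simp add: sos_length_le_iff)

lemma sos_length_le_1_iff: "sos_length a \<le> enat (Suc 0) \<longleftrightarrow> is_square a"
  unfolding sos_length_le_Suc_iff sos_length_le_0_iff by (auto simp: is_nth_power_def)

lemma sos_length_le_2_iff: "sos_length a \<le> enat (Suc (Suc 0)) \<longleftrightarrow> (\<exists>x y. a = x\<^sup>2 + y\<^sup>2)"
  unfolding sos_length_le_Suc_iff sos_length_le_0_iff
  by (simp add: diff_diff_eq)

lemma sos_length_le_3_iff:
  "sos_length a \<le> enat (Suc (Suc (Suc 0))) \<longleftrightarrow> (\<exists>x y z. a = x\<^sup>2 + y\<^sup>2 + z\<^sup>2)"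
  unfolding sos_length_le_Suc_iff sos_length_le_0_iff
  by (simp add: diff_diff_eq add.assoc)

lemma sos_length_le_4_iff:
  "sos_length a \<le> enat (Suc (Suc (Suc (Suc 0)))) \<longleftrightarrow> (\<exists>x y z w. a = x\<^sup>2 + y\<^sup>2 + z\<^sup>2 + w\<^sup>2)"
  unfolding sos_length_le_Suc_iff sos_length_le_0_iff
  by (simp add: diff_diff_eq add.assoc)

text \<open>Division by a nonzero square passes between the two equations. If t = 0, then -1 is a
  square and x^2 + y^2 represents everything.\<close>

lemma hilbert_symbol_minus_one_iff:
  fixes a :: "'a :: field"
  assumes two: "(2 :: 'a) \<noteq> 0" and a: "a \<noteq> 0"
  shows "hilbert_symbol (- 1) a = 1 \<longleftrightarrow> (\<exists>x y. a = x\<^sup>2 + y\<^sup>2)"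
proof -
  have "(\<exists>s t. - 1 * s\<^sup>2 + a * t\<^sup>2 = 1) \<longleftrightarrow> (\<exists>x y. a = x\<^sup>2 + y\<^sup>2)"
  proof
    assume "\<exists>s t. - 1 * s\<^sup>2 + a * t\<^sup>2 = 1"
    then obtain s t where st: "a * t\<^sup>2 = 1 + s\<^sup>2"
      by (auto simp: algebra_simps)
    show "\<exists>x y. a = x\<^sup>2 + y\<^sup>2"
    proof (cases "t = 0")
      case True
      then have s: "s\<^sup>2 = - 1"
        using st by (simp add: eq_neg_iff_add_eq_0 add.commute)
      obtain h k where "a = h\<^sup>2 + - 1 * k\<^sup>2"
        using two by (rule difference_of_two_squares)
      also have "\<dots> = h\<^sup>2 + (s * k)\<^sup>2"
        by (simp only: s power_mult_distrib)
      finally show ?thesis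
        by blast
    next
      case False
      then have "a = (1 / t)\<^sup>2 + (s / t)\<^sup>2"
        using st by (simp add: field_simps)
      then show ?thesis
        by blast
    qed
  next
    assume "\<exists>x y. a = x\<^sup>2 + y\<^sup>2"
    then obtain x y where xy: "a = x\<^sup>2 + y\<^sup>2"
      by blast
    \<comment> \<open>As a is nonzero, one of x and y is nonzero and may be put first.\<close>
    obtain p q where "p \<noteq> 0" "a = p\<^sup>2 + q\<^sup>2"
    proof (cases "x = 0")
      case True
      then show thesis
        using that[of y x] xy a by auto
    next
      case False
      then show thesis
        using that xy by blast
    qed
    then have "- 1 * (q / p)\<^sup>2 + a * (1 / p)\<^sup>2 = 1"
      by (simp add: power_divide field_simps)
    then show "\<exists>s t. - 1 * s\<^sup>2 + a * t\<^sup>2 = 1"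
      by blast
  qed
  then show ?thesis
    unfolding hilbert_symbol_def by simp
qed

text \<open>The level of a field is never 3. With n = z^2 + 1 = -(x^2 + y^2), the two-square
  identity writes (x^2 + y^2) n = -n^2 as a sum of two squares, which is divided by n^2.\<close>

lemma minus_one_sum_two_squares_if_three:
  fixes x y z :: "'a :: field"
  assumes "- 1 = x\<^sup>2 + y\<^sup>2 + z\<^sup>2"
  shows "\<exists>s t :: 'a. - 1 = s\<^sup>2 + t\<^sup>2"
proof (cases "z\<^sup>2 + 1 = 0")
  case True
  then have "z\<^sup>2 = - 1"
    by (simp only: eq_neg_iff_add_eq_0)
  then have "- 1 = z\<^sup>2 + 0\<^sup>2"
    by simp
  then show ?thesis
    by blast
next
  case False
  define n where "n = z\<^sup>2 + 1"
  have "x\<^sup>2 + y\<^sup>2 = (x\<^sup>2 + y\<^sup>2 + z\<^sup>2) - z\<^sup>2"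
    by simp
  also have "\<dots> = - n"
    by (simp add: n_def flip: assms)
  finally have n: "x\<^sup>2 + y\<^sup>2 = - n" .
  have "((x * z + y) / n)\<^sup>2 + ((y * z - x) / n)\<^sup>2 = ((x * z + y)\<^sup>2 + (y * z - x)\<^sup>2) / n\<^sup>2"
    by (simp only: power_divide add_divide_distrib[symmetric])
  also have "(x * z + y)\<^sup>2 + (y * z - x)\<^sup>2 = (x\<^sup>2 + y\<^sup>2) * n"
    by (simp add: n_def power2_eq_square algebra_simps)
  also have "\<dots> / n\<^sup>2 = - 1"
    using False unfolding n n_def[symmetric] by (simp add: power2_eq_square)
  finally show ?thesis
    by metis
qed

theorem (in dyadic_field) sos_length_eq:
  fixes a :: 'a
  assumes a: "a \<noteq> 0"
  shows "sos_length a =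
    (if is_square a then 1
     else if hilbert_symbol (- 1) a = 1 then 2
     else if hilbert_symbol (- 1) (- 1 :: 'a) = 1 \<or> \<not> is_square (- a) then 3
     else 4)"
proof -
  have two: "hilbert_symbol (- 1) a = 1 \<longleftrightarrow> (\<exists>x y. a = x\<^sup>2 + y\<^sup>2)"
    using two_nonzero a by (rule hilbert_symbol_minus_one_iff)
  have minus: "hilbert_symbol (- 1) (- 1 :: 'a) = 1 \<longleftrightarrow> (\<exists>x y :: 'a. - 1 = x\<^sup>2 + y\<^sup>2)"
    using two_nonzero by (intro hilbert_symbol_minus_one_iff) auto
  \<comment> \<open>If a = -r^2, then division by r^2 makes -1 a sum of three squares, hence of
    two.\<close>
  have three: "(\<exists>x y z. a = x\<^sup>2 + y\<^sup>2 + z\<^sup>2) \<longleftrightarrow>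
    hilbert_symbol (- 1) (- 1 :: 'a) = 1 \<or> \<not> is_square (- a)"
  proof (cases "is_square (- a)")
    case False
    then show ?thesis
      using sum_three_squares[OF a] by blast
  next
    case True
    then obtain r where r: "- a = r\<^sup>2"
      unfolding is_nth_power_def by blast
    have "r \<noteq> 0"
      using r a by auto
    have "\<exists>s t :: 'a. - 1 = s\<^sup>2 + t\<^sup>2" if "a = x\<^sup>2 + y\<^sup>2 + z\<^sup>2" for x y z
    proof (rule minus_one_sum_two_squares_if_three)
      have "a = - (r\<^sup>2)"
        using r by (metis minus_minus)
      then have "- 1 = a / r\<^sup>2"
        using \<open>r \<noteq> 0\<close> by simp
      then show "- 1 = (x / r)\<^sup>2 + (y / r)\<^sup>2 + (z / r)\<^sup>2"
        using that by (simp add: power_divide add_divide_distrib)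
    qed
    moreover have "\<exists>x y z. a = x\<^sup>2 + y\<^sup>2 + z\<^sup>2" if "- 1 = s\<^sup>2 + t\<^sup>2" for s t :: 'a
      using that sum_three_squares_if_minus_one[of s t a] by metis
    ultimately show ?thesis
      using True minus by blast
  qed
  have four: "\<exists>x y z w. a = x\<^sup>2 + y\<^sup>2 + z\<^sup>2 + w\<^sup>2" if "is_square (- a)"
    using that by (rule minus_square_sum_four_squares)
  have numerals: "1 = enat (Suc 0)" "2 = enat (Suc (Suc 0))" "3 = enat (Suc (Suc (Suc 0)))"
    "4 = enat (Suc (Suc (Suc (Suc 0))))"
    by (simp_all add: one_enat_def numeral_eq_enat numeral_eq_Suc)
  \<comment> \<open>The length is read off from consecutive bounds, and is not 0 as a is nonzero.
    Failure of the third condition makes -a a square, so four squares suffice.\<close>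
  show ?thesis
    unfolding numerals two three[symmetric]
    using a four three sos_length_eqI[of a 0] sos_length_eqI[of a "Suc 0"]
      sos_length_eqI[of a "Suc (Suc 0)"] sos_length_eqI[of a "Suc (Suc (Suc 0))"]
    unfolding sos_length_le_0_iff sos_length_le_1_iff sos_length_le_2_iff sos_length_le_3_iff
      sos_length_le_4_iff
    by presburger
qed

section \<open>Completions of number fields\<close>

text \<open>Integer rather than rational coefficients, not all of them even, so that a relation can be
  reduced modulo 2.\<close>

lemma number_field_integer_relation:
  assumes "number_field TYPE('k :: field_char_0)"
  obtains N where "\<And>f :: nat \<Rightarrow> 'k.
    \<exists>c :: nat \<Rightarrow> int. (\<exists>i\<le>N. odd (c i)) \<and> (\<Sum>i\<le>N. of_int (c i) * f i) = 0"
proof -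
  interpret vector_space "\<lambda>q :: rat. (*) (of_rat q :: 'k)"
    by unfold_locales (simp_all add: algebra_simps of_rat_add of_rat_mult)
  obtain B :: "'k set" where B: "finite B" "span B = UNIV"
    using assms unfolding number_field_def by blast
  define N where "N = card B"
  \<comment> \<open>N + 1 distinct elements exceed the size of a spanning set, and a repetition in f
    is itself a relation.\<close>
  have rational: "\<exists>q :: nat \<Rightarrow> rat. (\<exists>i\<le>N. q i \<noteq> 0) \<and> (\<Sum>i\<le>N. of_rat (q i) * f i) = 0"
    for f :: "nat \<Rightarrow> 'k"
  proof (cases "inj_on f {..N}")
    case True
    then have "card (f ` {..N}) = Suc (card B)"
      by (simp add: card_image N_def)
    then have "dependent (f ` {..N})"
      using independent_span_bound[OF B(1), of "f ` {..N}"] B(2) by auto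
    then obtain u where "\<exists>y\<in>f ` {..N}. u y \<noteq> 0" "(\<Sum>y\<in>f ` {..N}. of_rat (u y) * y) = 0"
      using dependent_finite[of "f ` {..N}"] by auto
    then show ?thesis
      using True by (intro exI[of _ "u \<circ> f"]) (auto simp: sum.reindex)
  next
    case False
    then obtain i j where ij: "i \<le> N" "j \<le> N" "i \<noteq> j" "f i = f j"
      unfolding inj_on_def by auto
    define q :: "nat \<Rightarrow> rat" where "q = (\<lambda>k. (if k = i then 1 else 0) - (if k = j then 1 else 0))"
    have "(\<Sum>k\<le>N. of_rat (q k) * f k) =
      (\<Sum>k\<le>N. (if k = i then f k else 0) - (if k = j then f k else 0))"
      by (intro sum.cong) (auto simp: q_def)
    also have "\<dots> = 0"
      using ij by (simp add: sum_subtractf)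
    finally show ?thesis
      using ij by (intro exI[of _ q]) (auto simp: q_def)
  qed
  have clear: "\<exists>D :: int. D \<noteq> 0 \<and> (\<forall>i\<le>n. \<exists>z. q i * of_int D = of_int z)"
    for q :: "nat \<Rightarrow> rat" and n
  proof (induction n)
    case 0
    obtain a b where "quotient_of (q 0) = (a, b)"
      by fastforce
    then have "b > 0" "q 0 = of_int a / of_int b"
      using quotient_of_denom_pos quotient_of_div by auto
    then show ?case
      by (intro exI[of _ b]) auto
  next
    case (Suc n)
    then obtain D :: int where D: "D \<noteq> 0" "\<And>i. i \<le> n \<Longrightarrow> \<exists>z. q i * of_int D = of_int z"
      by blast
    obtain a b where "quotient_of (q (Suc n)) = (a, b)"
      by fastforce
    then have ab: "b > 0" "q (Suc n) = of_int a / of_int b"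
      using quotient_of_denom_pos quotient_of_div by auto
    have "\<exists>z. q i * of_int (D * b) = of_int z" if "i \<le> Suc n" for i
    proof (cases "i = Suc n")
      case True
      then have "q i * of_int (D * b) = of_int (a * D)"
        using ab by simp
      then show ?thesis ..
    next
      case False
      then obtain z where "q i * of_int D = of_int z"
        using D(2) \<open>i \<le> Suc n\<close> le_Suc_eq by blast
      then have "q i * of_int (D * b) = of_int (z * b)"
        by (simp flip: mult.assoc)
      then show ?thesis ..
    qed
    then show ?case
      using D(1) ab(1) by (intro exI[of _ "D * b"]) auto
  qed
  show thesis
  proof
    fix f :: "nat \<Rightarrow> 'k"
    define R where "R c \<longleftrightarrow> (\<exists>i\<le>N. c i \<noteq> 0) \<and> (\<Sum>i\<le>N. of_int (c i) * f i) = 0" for c :: "nat \<Rightarrow> int"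
    obtain q :: "nat \<Rightarrow> rat" where q: "\<exists>i\<le>N. q i \<noteq> 0" "(\<Sum>i\<le>N. of_rat (q i) * f i) = 0"
      using rational by blast
    obtain D :: int where D: "D \<noteq> 0" "\<forall>i\<le>N. \<exists>z. q i * of_int D = of_int z"
      using clear by blast
    then obtain c where c: "\<And>i. i \<le> N \<Longrightarrow> q i * of_int D = of_int (c i)"
      by metis
    have "of_int (c i) = (of_rat (q i) * of_int D :: 'k)" if "i \<le> N" for i
      using arg_cong[OF c[OF that], of "of_rat :: rat \<Rightarrow> 'k"] by (simp add: of_rat_mult)
    then have "(\<Sum>i\<le>N. of_int (c i) * f i) = (\<Sum>i\<le>N. of_int D * (of_rat (q i) * f i))"
      by (intro sum.cong) auto
    also have "\<dots> = 0"
      using q(2) by (simp flip: sum_distrib_left)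
    finally have "R c"
      using q(1) D(1) c unfolding R_def by (metis mult_eq_0_iff of_int_0 of_int_eq_0_iff)
    \<comment> \<open>In a relation of least total size some coefficient is odd, since otherwise
      halving would give a smaller one.\<close>
    then obtain c where c: "R c" and least: "\<And>d. R d \<Longrightarrow> (\<Sum>i\<le>N. nat \<bar>c i\<bar>) \<le> (\<Sum>i\<le>N. nat \<bar>d i\<bar>)"
      using ex_has_least_nat[of R c "\<lambda>c. \<Sum>i\<le>N. nat \<bar>c i\<bar>"] by blast
    have "\<exists>i\<le>N. odd (c i)"
    proof (rule ccontr)
      assume neg: "\<not> ?thesis"
      define d where "d i = c i div 2" for i
      have d: "c i = 2 * d i" if "i \<le> N" for i
        using neg that by (simp add: d_def)
      have "2 * (\<Sum>i\<le>N. of_int (d i) * f i) = (\<Sum>i\<le>N. of_int (c i) * f i)"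
        by (simp add: d sum_distrib_left mult.assoc)
      then have "R d"
        using c d unfolding R_def by auto
      then have "(\<Sum>i\<le>N. nat \<bar>c i\<bar>) \<le> (\<Sum>i\<le>N. nat \<bar>d i\<bar>)"
        by (rule least)
      moreover have "(\<Sum>i\<le>N. nat \<bar>c i\<bar>) = 2 * (\<Sum>i\<le>N. nat \<bar>d i\<bar>)"
        by (simp add: d sum_distrib_left abs_mult nat_mult_distrib)
      ultimately have "(\<Sum>i\<le>N. nat \<bar>c i\<bar>) = 0"
        by simp
      then show False
        using c unfolding R_def by auto
    qed
    then show "\<exists>c. (\<exists>i\<le>N. odd (c i)) \<and> (\<Sum>i\<le>N. of_int (c i) * f i) = 0"
      using c unfolding R_def by blast
  qed
qed

text \<open>A single strictly largest term would determine the value of the sum.\<close>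

lemma (in finite_place) equal_val_if_sum_eq_0:
  assumes I: "finite I" and sum: "(\<Sum>i\<in>I. f i) = 0" and k: "k \<in> I" "f k \<noteq> 0"
  obtains i j where "i \<in> I" "j \<in> I" "i \<noteq> j" "f i \<noteq> 0" "v (f i) = v (f j)"
proof -
  have "Max ((\<lambda>i. v (f i)) ` I) \<in> (\<lambda>i. v (f i)) ` I"
    using I k(1) by (intro Max_in) auto
  then obtain i where i: "i \<in> I" "v (f i) = Max ((\<lambda>i. v (f i)) ` I)"
    by auto
  have max: "v (f j) \<le> v (f i)" if "j \<in> I" for j
    using that I by (simp add: i(2))
  have pos: "0 < v (f i)"
    using max[OF k(1)] k(2) val_pos_iff[of "f k"] by linarith
  show thesis
  proof (cases "\<exists>j\<in>I - {i}. v (f j) = v (f i)")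
    case True
    then obtain j where "j \<in> I - {i}" "v (f j) = v (f i)"
      by blast
    then show thesis
      using that[of i j] i(1) pos val_pos_iff[of "f i"] by auto
  next
    case False
    then have "v (\<Sum>j\<in>I - {i}. f j) < v (f i)"
      using I pos max by (intro val_sum_less) (auto simp: less_le)
    then have "v (f i + (\<Sum>j\<in>I - {i}. f j)) = v (f i)"
      by (rule val_add_eq)
    then show thesis
      using sum pos I i(1) by (simp add: sum.remove[of I i])
  qed
qed

text \<open>A relation between powers of x has two terms of equal value, so
  \<open>v x ^ (j - i)\<close> is an integral power of \<open>v 2\<close> for some 0 < j - i <= N.
  All these differences divide N!, so the N!-th root of \<open>v 2\<close> serves for every
  x.\<close>

lemma number_field_discrete:
  fixes v :: "'k :: field_char_0 \<Rightarrow> real"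
  assumes K: "number_field TYPE('k)" and "dyadic_place v"
  shows "\<exists>\<rho>. 0 < \<rho> \<and> \<rho> < 1 \<and> (\<forall>x. x \<noteq> 0 \<longrightarrow> (\<exists>z :: int. v x = \<rho> powi z))"
proof -
  interpret dyadic_place v by fact
  obtain N where N: "\<And>f :: nat \<Rightarrow> 'k.
    \<exists>c :: nat \<Rightarrow> int. (\<exists>i\<le>N. odd (c i)) \<and> (\<Sum>i\<le>N. of_int (c i) * f i) = 0"
    using number_field_integer_relation[OF K] by blast
  define F :: nat where "F = fact N"
  define \<rho> where "\<rho> = root F (v 2)"
  have F: "0 < F"
    by (simp add: F_def)
  have v2: "0 < v 2"
    by (simp add: val_pos_iff)
  have \<rho>: "0 < \<rho>" "\<rho> < 1" "\<rho> ^ F = v 2"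
    using F v2 dvd_2 by (simp_all add: \<rho>_def)
  have "\<exists>z :: int. v x = \<rho> powi z" if x: "x \<noteq> 0" for x
  proof -
    obtain c :: "nat \<Rightarrow> int" and k where k: "k \<le> N" "odd (c k)"
      and sum: "(\<Sum>i\<le>N. of_int (c i) * x ^ i) = 0"
      using N[of "\<lambda>i. x ^ i"] by blast
    have "of_int (c k) * x ^ k \<noteq> 0"
      using k(2) x by auto
    then obtain i j where ij: "i \<le> N" "j \<le> N" "i \<noteq> j" "of_int (c i) * x ^ i \<noteq> 0"
      "v (of_int (c i) * x ^ i) = v (of_int (c j) * x ^ j)"
      using equal_val_if_sum_eq_0[of "{..N}" "\<lambda>i. of_int (c i) * x ^ i" k] sum k(1) by auto
    have "of_int (c j) * x ^ j \<noteq> 0"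
      using ij(4,5) by (metis eq_0_iff)
    have pos: "0 < v x"
      using x by (simp add: val_pos_iff)
    have root: "\<exists>z. v x = \<rho> powi z"
      if "i < j" "j \<le> N" "c i \<noteq> 0" "c j \<noteq> 0" "v (of_int (c i)) * v x ^ i = v (of_int (c j)) * v x ^ j"
      for i j
    proof -
      obtain m n where mn: "v (of_int (c i)) = v 2 ^ m" "v (of_int (c j)) = v 2 ^ n"
        using val_of_int_power_2 \<open>c i \<noteq> 0\<close> \<open>c j \<noteq> 0\<close> by metis
      have "v x ^ j = v x ^ i * v x ^ (j - i)"
        using \<open>i < j\<close> by (simp flip: power_add)
      then have "v x ^ (j - i) = v 2 ^ m / v 2 ^ n"
        using \<open>v (of_int (c i)) * v x ^ i = _\<close> pos v2 by (simp add: mn field_simps)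
      then have *: "v x ^ (j - i) = v 2 powi (int m - int n)"
        using v2 by (simp add: power_int_diff)
      have "(j - i) dvd F"
        unfolding F_def using \<open>i < j\<close> \<open>j \<le> N\<close> by (intro dvd_fact) auto
      then obtain e where e: "F = (j - i) * e" ..
      have "v x ^ F = (v 2 powi (int m - int n)) ^ e"
        by (simp add: e power_mult *)
      also have "\<dots> = \<rho> powi (int F * ((int m - int n) * int e))"
        by (simp add: power_int_mult flip: \<rho>(3))
      also have "\<dots> = (\<rho> powi ((int m - int n) * int e)) ^ F"
        by (subst mult.commute) (simp add: power_int_mult)
      finally have "v x = \<rho> powi ((int m - int n) * int e)"
        using F pos \<rho>(1) by (subst (asm) power_eq_iff_eq_base) auto
      then show ?thesis ..
    qed
    show ?thesis
      using ij \<open>of_int (c j) * x ^ j \<noteq> 0\<close> root[of i j] root[of j i]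
      by (cases "i < j") (auto simp: mult val_power)
  qed
  then show ?thesis
    using \<rho> by blast
qed

text \<open>In an infinite residue field one could choose elements successively, each avoiding all
  subset sums of its predecessors. They would be independent over the field with two elements,
  whereas a relation with an odd coefficient reduces to a dependence.\<close>

lemma number_field_finite_residue_field:
  fixes v :: "'k :: field_char_0 \<Rightarrow> real"
  assumes K: "number_field TYPE('k)" and "dyadic_place v"
  shows "\<exists>R. finite R \<and> (\<forall>x. v x \<le> 1 \<longrightarrow> (\<exists>r\<in>R. v (x - r) < 1))"
proof (rule ccontr)
  interpret dyadic_place v by fact
  obtain N where N: "\<And>f :: nat \<Rightarrow> 'k.
    \<exists>c :: nat \<Rightarrow> int. (\<exists>i\<le>N. odd (c i)) \<and> (\<Sum>i\<le>N. of_int (c i) * f i) = 0"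
    using number_field_integer_relation[OF K] by blast
  assume "\<not> ?thesis"
  then have "\<forall>R. \<exists>x. finite R \<longrightarrow> v x \<le> 1 \<and> (\<forall>r\<in>R. \<not> v (x - r) < 1)"
    by blast
  then obtain new where new: "\<And>R. finite R \<Longrightarrow> v (new R) \<le> 1"
    "\<And>R r. finite R \<Longrightarrow> r \<in> R \<Longrightarrow> \<not> v (new R - r) < 1"
    by metis
  \<comment> \<open>\<open>G i\<close> contains the subset sums of the first i chosen
    elements.\<close>
  define G where "G = rec_nat {0} (\<lambda>_ R. R \<union> (+) (new R) ` R)"
  define f where "f i = new (G i)" for i
  have G_0: "G 0 = {0}" and G_Suc: "G (Suc i) = G i \<union> (+) (f i) ` G i" for i
    by (simp_all add: G_def f_def)
  have fin: "finite (G i)" for i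
    by (induction i) (simp_all add: G_0 G_Suc)
  have subset_sum: "(\<Sum>i\<in>S. f i) \<in> G n" if "S \<subseteq> {..<n}" for S n
    using that
  proof (induction n arbitrary: S)
    case (Suc n)
    show ?case
    proof (cases "n \<in> S")
      case True
      have "finite S"
        using Suc.prems by (rule finite_subset) simp
      moreover have "(\<Sum>i\<in>S - {n}. f i) \<in> G n"
        using Suc.prems by (intro Suc.IH) (auto simp: less_Suc_eq)
      ultimately show ?thesis
        using True by (simp add: sum.remove[of S n] G_Suc)
    next
      case False
      then have "S \<subseteq> {..<n}"
        using Suc.prems by (auto simp: less_Suc_eq)
      then show ?thesis
        using Suc.IH by (simp add: G_Suc)
    qed
  qed (simp add: G_0)
  obtain c :: "nat \<Rightarrow> int" where c: "\<exists>i\<le>N. odd (c i)" "(\<Sum>i\<le>N. of_int (c i) * f i) = 0"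
    using N by blast
  \<comment> \<open>Modulo the maximal ideal the relation expresses the last term with an odd
    coefficient through the earlier ones.\<close>
  define n where "n = Max {i. i \<le> N \<and> odd (c i)}"
  have "n \<in> {i. i \<le> N \<and> odd (c i)}"
    unfolding n_def using c(1) by (intro Max_in) auto
  then have n: "n \<le> N" "odd (c n)"
    by auto
  have above: "even (c i)" if "n < i" "i \<le> N" for i
  proof (rule ccontr)
    assume "odd (c i)"
    then have "i \<le> n"
      unfolding n_def using that by (intro Max_ge) auto
    then show False
      using that by simp
  qed
  define S where "S = {i. i < n \<and> odd (c i)}"
  define r where "r = (\<Sum>i\<in>S. f i)"
  have f_le: "v (f i) \<le> 1" for i
    using new(1) fin by (simp add: f_def)
  have "r \<in> G n"
    unfolding r_def by (rule subset_sum) (auto simp: S_def)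
  then have far: "\<not> v (f n - r) < 1"
    using new(2) fin by (simp add: f_def)
  have fin_S: "finite S"
    by (simp add: S_def)
  \<comment> \<open>Adding r - f n to the relation makes all coefficients even, so r - f n has value
    below 1.\<close>
  define d where "d i = (if i = n then c n - 1 else if i \<in> S then c i + 1 else c i)" for i
  have "even (d i)" if "i \<le> N" for i
    using that above[of i] n(2) by (cases i n rule: linorder_cases) (auto simp: d_def S_def)
  then have "v (\<Sum>i\<le>N. of_int (d i) * f i) < 1"
    by (intro val_sum_less val_mult_less_1 val_of_int_even f_le) auto
  also have "(\<Sum>i\<le>N. of_int (d i) * f i) =
    (\<Sum>i\<le>N. of_int (c i) * f i - (if i = n then f i else 0) + (if i \<in> S then f i else 0))"
    by (intro sum.cong) (auto simp: d_def S_def algebra_simps)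
  also have "\<dots> = r - f n"
  proof -
    have "{..N} \<inter> S = S"
      using n(1) by (auto simp: S_def)
    then show ?thesis
      using n(1) c(2) by (simp add: sum.distrib sum_subtractf r_def flip: sum.inter_restrict)
  qed
  finally show False
    using far by (simp add: val_minus_commute)
qed

text \<open>By density every nonzero element has the value, and every integral one the residue
  class, of an element of the image. So value group and residue field do not grow.\<close>

lemma (in valued_field_completion) dyadic_field_completion:
  assumes "dyadic_place v"
    and discrete: "\<exists>\<rho>. 0 < \<rho> \<and> \<rho> < 1 \<and> (\<forall>x. x \<noteq> 0 \<longrightarrow> (\<exists>z :: int. v x = \<rho> powi z))"
    and residue: "\<exists>R. finite R \<and> (\<forall>x. v x \<le> 1 \<longrightarrow> (\<exists>r\<in>R. v (x - r) < 1))"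
    and two: "(2 :: 'k) \<noteq> 0"
  shows "dyadic_field w"
proof -
  interpret v: dyadic_place v by fact
  have hom_0: "\<iota> 0 = 0"
    using hom_add[of 0 0] by (metis add_0 add_left_cancel add_0_right)
  have hom_minus: "\<iota> (- x) = - \<iota> x" for x
    using hom_add[of x "- x"] by (simp add: hom_0 eq_neg_iff_add_eq_0 add.commute)
  have hom_diff: "\<iota> (x - y) = \<iota> x - \<iota> y" for x y
    using hom_add[of x "- y"] by (simp add: hom_minus)
  have hom_2: "\<iota> 2 = 2"
    using hom_add[of 1 1] by (simp add: hom_one)
  have approx: "\<exists>y. w (x - \<iota> y) < \<epsilon>" if "0 < \<epsilon>" for x \<epsilon>
  proof -
    have "x \<in> Metric_space.mtopology UNIV (val_dist w) closure_of range \<iota>"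
      using dense by simp
    then show ?thesis
      using that unfolding Metric_space.metric_closure_of[OF compl.Metric_space_val_dist]
        Metric_space.in_mball[OF compl.Metric_space_val_dist]
      by (auto simp: val_dist_def)
  qed
  \<comment> \<open>At this point only the triangle inequality is known on the completion; the
    approximation errors are kept below \<open>\<epsilon>\<close> in total.\<close>
  have ultrametric: "w (x + y) \<le> max (w x) (w y)" for x y
  proof (rule field_le_epsilon)
    fix \<epsilon> :: real assume "0 < \<epsilon>"
    then obtain p q where pq: "w (x - \<iota> p) < \<epsilon> / 4" "w (y - \<iota> q) < \<epsilon> / 4"
      using approx[of "\<epsilon> / 4"] by fastforce
    have "w (\<iota> p) \<le> w x + \<epsilon> / 4" "w (\<iota> q) \<le> w y + \<epsilon> / 4"
      using pq compl.triangle[of x "\<iota> p - x"] compl.triangle[of y "\<iota> q - y"]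
      by (auto simp: compl.val_minus_commute[of x] compl.val_minus_commute[of y])
    moreover have "w (\<iota> (p + q)) \<le> max (w (\<iota> p)) (w (\<iota> q))"
      by (simp add: isometric v.ultrametric)
    moreover have "w (x + y) \<le> w (\<iota> (p + q)) + w (x - \<iota> p) + w (y - \<iota> q)"
      using compl.triangle[of "\<iota> (p + q)" "(x - \<iota> p) + (y - \<iota> q)"]
        compl.triangle[of "x - \<iota> p" "y - \<iota> q"]
      by (simp add: hom_add)
    ultimately show "w (x + y) \<le> max (w x) (w y) + \<epsilon>"
      using pq \<open>0 < \<epsilon>\<close> by linarith
  qed
  have two': "(2 :: 'l) \<noteq> 0"
    using isometric[of 2] two by (metis base.eq_0_iff compl.val_0 hom_2)
  interpret w: dyadic_place w
  proof
    show "\<exists>x. x \<noteq> 0 \<and> w x \<noteq> 1"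
      using two' isometric[of 2] v.dvd_2 by (intro exI[of _ 2]) (simp add: hom_2)
    show "w 2 < 1"
      using isometric[of 2] v.dvd_2 by (simp add: hom_2)
  qed (rule ultrametric)
  show ?thesis
  proof
    show "(2 :: 'l) \<noteq> 0"
      by (rule two')
    show "Metric_space.mcomplete UNIV (val_dist w)"
      by (rule complete)
    obtain R where R: "finite R" "\<And>x. v x \<le> 1 \<Longrightarrow> \<exists>r\<in>R. v (x - r) < 1"
      using residue by blast
    have "\<exists>r\<in>\<iota> ` R. w (x - r) < 1" if "w x \<le> 1" for x
    proof -
      obtain y where y: "w (x - \<iota> y) < 1"
        using approx[of 1] by auto
      have "v y \<le> 1"
        using y that w.val_diff_le[of x "x - \<iota> y"] by (simp add: isometric)
      then obtain r where r: "r \<in> R" "v (y - r) < 1"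
        using R(2) by blast
      have "w (\<iota> y - \<iota> r) < 1"
        using r(2) isometric[of "y - r"] by (simp add: hom_diff)
      then have "w (x - \<iota> r) < 1"
        using y w.val_congruent_trans by blast
      then show ?thesis
        using r(1) by blast
    qed
    then show "\<exists>R. finite R \<and> (\<forall>x. w x \<le> 1 \<longrightarrow> (\<exists>r\<in>R. w (x - r) < 1))"
      using R(1) by blast
    obtain \<rho> where \<rho>: "0 < \<rho>" "\<rho> < 1" "\<And>x. x \<noteq> 0 \<Longrightarrow> \<exists>z :: int. v x = \<rho> powi z"
      using discrete by blast
    have "\<exists>z :: int. w x = \<rho> powi z" if x: "x \<noteq> 0" for x
    proof -
      obtain y where "w (x - \<iota> y) < w x"
        using approx[of "w x"] x by (auto simp: compl.val_pos_iff)
      then have "w (\<iota> y) = w x"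
        by (rule w.val_eq_of_close)
      then have eq: "v y = w x"
        by (simp only: isometric)
      moreover have "w x \<noteq> 0"
        using x by (simp only: compl.eq_0_iff not_False_eq_True)
      ultimately have "y \<noteq> 0"
        by auto
      then show ?thesis
        using \<rho>(3) unfolding eq[symmetric] by blast
    qed
    then show "\<exists>\<rho>. 0 < \<rho> \<and> \<rho> < 1 \<and> (\<forall>x. x \<noteq> 0 \<longrightarrow> (\<exists>z :: int. w x = \<rho> powi z))"
      using \<rho>(1,2) by blast
  qed
qed

theorem mainTheorem2:
  fixes v :: "'k :: field_char_0 \<Rightarrow> real"
    and w :: "'l :: field \<Rightarrow> real"
    and \<iota> :: "'k \<Rightarrow> 'l"
    and a :: 'k
  assumes "number_field TYPE('k)"
    and "dyadic_place v"
    and "valued_field_completion v w \<iota>"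
    and "a \<noteq> 0"
  shows "sos_length (\<iota> a) =
    (if is_square (\<iota> a) then 1
     else if hilbert_symbol (- 1) (\<iota> a) = 1 then 2
     else if hilbert_symbol (- 1) (- 1 :: 'l) = 1 \<or> \<not> is_square (- \<iota> a) then 3
     else 4)"
proof -
  interpret valued_field_completion v w \<iota> by fact
  interpret dyadic_field w
    using assms(1,2)
    by (intro dyadic_field_completion number_field_discrete number_field_finite_residue_field) auto
  have "\<iota> a \<noteq> 0"
    using assms(4) isometric[of a] by (metis base.eq_0_iff compl.val_0)
  then show ?thesis
    by (rule sos_length_eq)
qed

end
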